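(* Let $n\ge 1$, let $m$ be any probability density function on the unit sphere of $\mathbb{R}^n$, let $\lambda\ge 0$ and let $\beta\in(0,1)\cup(1,2)$. Let $\Delta_m^{\beta/2,\lambda}$ be the anisotropic (tempered) fractional Laplacian ($\Delta_m^{\beta/2}:=\Delta_m^{\beta/2,0}$) defined by the following integrals. Case I ($0<\beta<1$, or $m$ symmetric): $$\Delta_m^{\beta/2,\lambda}p(X)=\frac{1}{|\Gamma(-\beta)|}\int_{\mathbb{R}^n\setminus\{0\}}\big[p(X-Y)-p(X)\big]\frac{m(Y)}{e^{\lambda|Y|}|Y|^{n+\beta}}\,dY .$$ Case II ($1<\beta<2$ and $m$ not symmetric): $$\Delta_m^{\beta/2,\lambda}p(X)=\frac{1}{|\Gamma(-\beta)|}\int_{\mathbb{R}^n\setminus\{0\}}\big[p(X-Y)-p(X)+Y\cdot\nabla p(X)\big]\frac{m(Y)}{e^{\lambda|Y|}|Y|^{n+\beta}}\,dY-\frac{\Gamma(1-\beta)\lambda^{\beta-1}}{|\Gamma(-\beta)|}\,\mathbf{b}\cdot\nabla p(X),$$ where $\mathbf{b}=\int_{|\phi|=1}\phi\, m(\phi)\,d\phi$. Then, in both Case I and Case II, this definition is equivalent to the definition in Fourier space: for every Schwartz function $p$ on $\mathbb{R}^n$ and every $k\in\mathbb{R}^n$, $$\mathscr{F}\big[\Delta_m^{\beta/2,\lambda}p\big](k)=(-1)^{\lceil\beta\rceil}\left[\int_{|\phi|=1}\Big((\lambda-i\,k\cdot\phi)^\beta-\lambda^\beta\Big)m(\phi)\,d\phi\right]\hat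 p(k).$$ In particular, for $\lambda=0$, $$\mathscr{F}\big[\Delta_m^{\beta/2}p\big](k)=(-1)^{\lceil\beta\rceil}\left[\int_{|\phi|=1}(-i\,k\cdot\phi)^\beta m(\phi)\,d\phi\right]\hat p(k).$$
   Context: A probability density function on the unit sphere $\{|\phi|=1\}\subset\mathbb{R}^n$ is a function $m\ge0$ with $\int_{|\phi|=1}m(\phi)\,d\phi=1$, where $d\phi$ is surface measure (counting measure on $\{\pm1\}$ if $n=1$). For $Y\in\mathbb{R}^n\setminus\{0\}$, $m(Y)$ means $m(Y/|Y|)$. $m$ is symmetric if $m(-\phi)=m(\phi)$. When $1<\beta<2$ and $m$ is symmetric, the integral in Case I is understood as a Cauchy principal value at the origin, i.e. $\lim_{\varepsilon\to0}\int_{|Y|>\varepsilon}$. The Fourier transform is $\mathscr{F}[g](k)=\hat g(k)=\int_{\mathbb{R}^n}e^{ik\cdot X}g(X)\,dX$. $\lceil\beta\rceil$ is the smallest integer $\ge\beta$. Complex powers $z^\beta$ with $\operatorname{Re} z\ge0$ use the principal branch, $0^\beta=0$, and $\lambda^{\beta-1}=0$ if $\lambda=0$ and $\beta>1$; explicitly, $(\lambda-ik\cdot\phi)^\beta=(\lambda^2+(k\cdot\phi)^2)^{\beta/2}e^{-i\beta\eta}$ with $\eta=\arctan\big(\frac{k\cdot\phi}{\lambda}\big)$. The expression in Case II is the Hadamard finite part of the Case I integral. *)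

theory Defs
  imports "HOL-Analysis.Analysis"
begin

text \<open>
  Surface measure on the unit sphere, as the cone measure: a Borel set \<open>A\<close> of the sphere has
  measure \<open>n\<close> times the volume of \<open>{x. 0 < |x| \<le> 1 \<and> x/|x| \<in> A}\<close>, where \<open>n\<close> is the dimension of
  the ambient space. For \<open>n = 1\<close> this is the counting measure on the two unit vectors. It is
  completed, so that densities need only be Lebesgue measurable.
\<close>

definition surface_measure :: "'a::euclidean_space measure" where
  "surface_measure =
     completion (scale_measure (of_nat DIM('a))
       (distr (restrict_space lborel (cball 0 1 - {0})) (restrict_space borel (sphere 0 1))
          (\<lambda>x. x /\<^sub>R norm x)))"

lemma emeasure_surface_measure:
  fixes A :: "'a::euclidean_space set"
  assumes "A \<in> sets borel" "A \<subseteq> sphere 0 1"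
  shows "emeasure surface_measure A =
           of_nat DIM('a) * emeasure lborel {x. 0 < norm x \<and> norm x \<le> 1 \<and> x /\<^sub>R norm x \<in> A}"
proof -
  let ?B = "cball 0 1 - {0} :: 'a set"
  let ?S = "restrict_space borel (sphere 0 1) :: 'a measure"
  let ?u = "\<lambda>x::'a. x /\<^sub>R norm x"
  have B: "?B \<in> sets lborel" by simp
  have A: "A \<in> sets ?S"
    using assms by (auto simp: sets_restrict_space_iff)
  have u: "?u \<in> measurable (restrict_space lborel ?B) ?S"
    by (rule measurable_restrict_space2, force simp: space_restrict_space,
        rule measurable_restrict_space1, simp)
  have "emeasure surface_measure A =
          of_nat DIM('a) * emeasure (distr (restrict_space lborel ?B) ?S ?u) A"
    unfolding surface_measure_def using A
    by (subst emeasure_completion) (auto simp: main_part_sets)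
  also have "\<dots> = of_nat DIM('a) * emeasure (restrict_space lborel ?B)
                     (?u -` A \<inter> space (restrict_space lborel ?B))"
    by (simp only: emeasure_distr[OF u A])
  also have "\<dots> = of_nat DIM('a) * emeasure lborel (?u -` A \<inter> ?B)"
    by (subst emeasure_restrict_space) (auto simp: space_restrict_space)
  also have "?u -` A \<inter> ?B = {x. 0 < norm x \<and> norm x \<le> 1 \<and> ?u x \<in> A}"
    by auto
  finally show ?thesis .
qed

definition sphere_density :: "('a::euclidean_space \<Rightarrow> real) \<Rightarrow> bool" where
  "sphere_density m \<longleftrightarrow>
     (\<forall>\<phi>\<in>sphere 0 1. 0 \<le> m \<phi>) \<and> has_bochner_integral surface_measure m 1"

definition sphere_symmetric :: "('a::euclidean_space \<Rightarrow> real) \<Rightarrow> bool" where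
  "sphere_symmetric m \<longleftrightarrow> (\<forall>\<phi>\<in>sphere 0 1. m (- \<phi>) = m \<phi>)"

fun iter_partial :: "'a::euclidean_space list \<Rightarrow> ('a \<Rightarrow> complex) \<Rightarrow> 'a \<Rightarrow> complex" where
  "iter_partial [] p = p"
| "iter_partial (b # bs) p = (\<lambda>x. frechet_derivative (iter_partial bs p) (at x) b)"

text \<open>
  Differentiability of all iterated partial derivatives amounts to \<open>p\<close> being of class \<open>C\<^sup>\<infinity>\<close>.
\<close>

definition schwartz :: "('a::euclidean_space \<Rightarrow> complex) \<Rightarrow> bool" where
  "schwartz p \<longleftrightarrow>
     (\<forall>bs\<in>lists Basis.
        (\<forall>x. iter_partial bs p differentiable at x) \<and>
        (\<forall>N::nat. bounded (range (\<lambda>x. norm x ^ N *\<^sub>R iter_partial bs p x))))"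

definition fourier :: "('a::euclidean_space \<Rightarrow> complex) \<Rightarrow> 'a \<Rightarrow> complex" where
  "fourier g k = (LINT X|lebesgue. exp (\<i> * complex_of_real (k \<bullet> X)) * g X)"

text \<open>The expression \<open>v \<cdot> \<nabla>p(X)\<close> for complex-valued \<open>p\<close>.\<close>

definition dot_grad :: "'a::euclidean_space \<Rightarrow> ('a \<Rightarrow> complex) \<Rightarrow> 'a \<Rightarrow> complex" where
  "dot_grad v p X = (\<Sum>i\<in>Basis. (v \<bullet> i) *\<^sub>R frechet_derivative p (at X) i)"

definition tempered_kernel :: "real \<Rightarrow> real \<Rightarrow> ('a::euclidean_space \<Rightarrow> real) \<Rightarrow> 'a \<Rightarrow> real" where
  "tempered_kernel \<beta> lam m Y =
     m (Y /\<^sub>R norm Y) / (exp (lam * norm Y) * norm Y powr (real DIM('a) + \<beta>))"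

definition integrand_I ::
  "real \<Rightarrow> real \<Rightarrow> ('a::euclidean_space \<Rightarrow> real) \<Rightarrow> ('a \<Rightarrow> complex) \<Rightarrow> 'a \<Rightarrow> 'a \<Rightarrow> complex" where
  "integrand_I \<beta> lam m p X Y =
     (p (X - Y) - p X) * complex_of_real (tempered_kernel \<beta> lam m Y)"

definition integrand_II ::
  "real \<Rightarrow> real \<Rightarrow> ('a::euclidean_space \<Rightarrow> real) \<Rightarrow> ('a \<Rightarrow> complex) \<Rightarrow> 'a \<Rightarrow> 'a \<Rightarrow> complex" where
  "integrand_II \<beta> lam m p X Y =
     (p (X - Y) - p X + dot_grad Y p X) * complex_of_real (tempered_kernel \<beta> lam m Y)"

definition drift :: "('a::euclidean_space \<Rightarrow> real) \<Rightarrow> 'a" where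
  "drift m = (LINT \<phi>|surface_measure. m \<phi> *\<^sub>R \<phi>)"

text \<open>
  The operator, meant for \<open>\<beta> \<in> (0,1) \<union> (1,2)\<close>. The second branch is the principal value used for
  symmetric \<open>m\<close> when \<open>1 < \<beta>\<close>. Note \<open>0 powr (\<beta> - 1) = 0\<close>.
\<close>

definition frac_laplacian ::
  "real \<Rightarrow> real \<Rightarrow> ('a::euclidean_space \<Rightarrow> real) \<Rightarrow> ('a \<Rightarrow> complex) \<Rightarrow> 'a \<Rightarrow> complex" where
  "frac_laplacian \<beta> lam m p X =
     (if \<beta> < 1 then
        complex_of_real (1 / \<bar>Gamma (- \<beta>)\<bar>) *
          (LINT Y:- {0}|lebesgue. integrand_I \<beta> lam m p X Y)
      else if sphere_symmetric m then
        complex_of_real (1 / \<bar>Gamma (- \<beta>)\<bar>) *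
          Lim (at_right 0) (\<lambda>\<epsilon>. LINT Y:{Y. \<epsilon> < norm Y}|lebesgue. integrand_I \<beta> lam m p X Y)
      else
        complex_of_real (1 / \<bar>Gamma (- \<beta>)\<bar>) *
          (LINT Y:- {0}|lebesgue. integrand_II \<beta> lam m p X Y)
        - complex_of_real (Gamma (1 - \<beta>) * lam powr (\<beta> - 1) / \<bar>Gamma (- \<beta>)\<bar>) *
          dot_grad (drift m) p X)"

text \<open>
  Existence of the integral (or principal value) in the corresponding branch of
  \<open>frac_laplacian\<close>, needed because \<open>LINT\<close> and \<open>Lim\<close> are total.
\<close>

definition frac_laplacian_exists ::
  "real \<Rightarrow> real \<Rightarrow> ('a::euclidean_space \<Rightarrow> real) \<Rightarrow> ('a \<Rightarrow> complex) \<Rightarrow> 'a \<Rightarrow> bool" where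
  "frac_laplacian_exists \<beta> lam m p X \<longleftrightarrow>
     (if \<beta> < 1 then set_integrable lebesgue (- {0}) (integrand_I \<beta> lam m p X)
      else if sphere_symmetric m then
        (\<forall>\<epsilon>>0. set_integrable lebesgue {Y. \<epsilon> < norm Y} (integrand_I \<beta> lam m p X)) \<and>
        (\<exists>l. ((\<lambda>\<epsilon>. LINT Y:{Y. \<epsilon> < norm Y}|lebesgue. integrand_I \<beta> lam m p X Y) \<longlongrightarrow> l)
               (at_right 0))
      else set_integrable lebesgue (- {0}) (integrand_II \<beta> lam m p X))"

end

theory Submission
  imports Defs "HOL-Real_Asymp.Real_Asymp"
begin

text \<open>
  Translation by \<open>Y\<close> multiplies the transform by \<open>exp (i k \<bullet> Y)\<close>, so by Fubini the transform of the
  operator is \<open>fourier p k\<close> times the integral of \<open>exp (i k \<bullet> Y) - 1\<close> (minus \<open>i k \<bullet> Y\<close> when the gradient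
  term is present) against the kernel. In polar coordinates the radial part of that integral is a
  regularized Gamma integral with rate \<open>lam - i k \<bullet> \<phi>\<close>; its value follows for \<open>lam > 0\<close> by solving a
  differential equation in the frequency, and for \<open>lam = 0\<close> by dominated convergence. The linear
  term it produces cancels the drift term of the operator. For symmetric \<open>m\<close> and \<open>\<beta> > 1\<close> the gradient
  term integrates to zero outside every ball, so the principal value equals the compensated integral.
\<close>

section \<open>Integrals over the half-line\<close>

text \<open>The power \<open>r powr (- 1 - \<beta>)\<close> is not integrable at 0, so the Gamma
  integral with exponent \<open>- \<beta>\<close> exists only after subtracting Taylor terms of the
  exponential: the constant for \<beta> < 1, also the linear term for \<beta> > 1. The subtracted
  terms must still converge at infinity, and there exponential damping is no help, since
  \<open>lam = 0\<close> is allowed. \<open>weight b\<close> records both demands; its integrability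
  against the radial power is where the range of \<beta> enters. The same factor bounds increments
  of Schwartz functions, so one estimate serves both Fubini and the symbol. A positive rate comes
  first because the differential equation starts at frequency 0, which for rate 0 is the branch
  point of the power. The sign \<open>(- 1) ^ nat \<lceil>\<beta>\<rceil>\<close> is that of
  \<open>Gamma (- \<beta>)\<close>, left over from normalizing by its absolute value. A last
  obstacle is measurability: the density is measurable only for the completed surface measure, while
  product measures are formed from uncompleted ones, hence the Borel version of the density.\<close>

lemma has_vector_derivative_integral:
  fixes f :: "real \<Rightarrow> 'a \<Rightarrow> complex"
  assumes "0 < \<delta>"
    and int: "\<And>v. \<bar>v - u\<bar> < \<delta> \<Longrightarrow> integrable M (f v)"
    and der: "\<And>r. r \<in> space M \<Longrightarrow> ((\<lambda>v. f v r) has_vector_derivative f' r) (at u)"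
    and lip: "\<And>v r. r \<in> space M \<Longrightarrow> \<bar>v - u\<bar> < \<delta> \<Longrightarrow> norm (f v r - f u r) \<le> \<bar>v - u\<bar> * g r"
    and le: "\<And>r. r \<in> space M \<Longrightarrow> norm (f' r) \<le> g r"
    and g: "integrable M g"
    and f'[measurable]: "f' \<in> borel_measurable M"
  shows "((\<lambda>v. LINT r|M. f v r) has_vector_derivative (LINT r|M. f' r)) (at u)"
proof -
  have f'_int: "integrable M f'"
    by (rule Bochner_Integration.integrable_bound[OF g])
      (auto intro!: AE_I2 order_trans[OF le])
  \<comment> \<open>The difference quotient is treated along sequences, the form in which dominated
    convergence applies.\<close>
  have "((\<lambda>y. (1 / norm (y - u)) *\<^sub>R
     ((LINT r|M. f y r) - ((LINT r|M. f u r) + (y - u) *\<^sub>R (LINT r|M. f' r)))) \<longlongrightarrow> 0) (at u)"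
    unfolding tendsto_at_iff_sequentially
  proof (intro allI impI)
    fix X :: "nat \<Rightarrow> real"
    assume X: "\<forall>i. X i \<in> UNIV - {u}" "X \<longlonglongrightarrow> u"
    from tendstoD[OF X(2) \<open>0 < \<delta>\<close>] obtain N where N: "\<And>i. i \<ge> N \<Longrightarrow> \<bar>X i - u\<bar> < \<delta>"
      unfolding eventually_sequentially dist_real_def by blast
    \<comment> \<open>Dropping the first \<open>N\<close> terms puts the whole sequence into the
      \<delta>-neighbourhood of \<open>u\<close>, where \<open>int\<close> and \<open>lip\<close>
      apply.\<close>
    define Y where "Y i = X (i + N)" for i
    have Y: "Y \<longlonglongrightarrow> u" "\<And>i. Y i \<noteq> u" "\<And>i. \<bar>Y i - u\<bar> < \<delta>"
      using LIMSEQ_ignore_initial_segment[OF X(2), of N] X(1) N by (auto simp: Y_def[abs_def])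
    let ?s = "\<lambda>i r. (1 / norm (Y i - u)) *\<^sub>R (f (Y i) r - (f u r + (Y i - u) *\<^sub>R f' r))"
    have "(\<lambda>i. LINT r|M. ?s i r) \<longlonglongrightarrow> (LINT r|M. 0)"
    proof (rule integral_dominated_convergence[where w="\<lambda>r. 2 * g r"])
      show "?s i \<in> borel_measurable M" for i
        using int[OF Y(3)] int[of u] \<open>0 < \<delta>\<close> by (measurable; auto)
      show "integrable M (\<lambda>r. 2 * g r)" using g by simp
      show "AE r in M. (\<lambda>i. ?s i r) \<longlonglongrightarrow> 0"
      proof (rule AE_I2)
        fix r assume "r \<in> space M"
        from der[OF this] have "((\<lambda>y. (1 / norm (y - u)) *\<^sub>R (f y r - (f u r + (y - u) *\<^sub>R f' r)))
            \<longlongrightarrow> 0) (at u)"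
          unfolding has_vector_derivative_def has_derivative_within by simp
        from this[unfolded tendsto_at_iff_sequentially, rule_format, of Y] Y
        show "(\<lambda>i. ?s i r) \<longlonglongrightarrow> 0" by (simp add: o_def)
      qed
      \<comment> \<open>One \<open>g\<close> bounds the quotient of increments by
        \<open>lip\<close>, the other bounds \<open>f'\<close> by \<open>le\<close>.\<close>
      show "AE r in M. norm (?s i r) \<le> 2 * g r" for i
      proof (rule AE_I2)
        fix r assume r: "r \<in> space M"
        have "norm (f (Y i) r - (f u r + (Y i - u) *\<^sub>R f' r))
            \<le> norm (f (Y i) r - f u r) + norm ((Y i - u) *\<^sub>R f' r)"
          using norm_triangle_ineq4[of "f (Y i) r - f u r" "(Y i - u) *\<^sub>R f' r"]
          by (simp add: diff_diff_add)
        also have "\<dots> \<le> \<bar>Y i - u\<bar> * g r + \<bar>Y i - u\<bar> * g r"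
          using lip[OF r Y(3)] le[OF r] by (intro add_mono) (auto intro: mult_left_mono)
        finally show "norm (?s i r) \<le> 2 * g r"
          using Y(2)[of i] unfolding norm_scaleR by (simp add: divide_le_eq mult.commute mult.left_commute)
      qed
    qed auto
    moreover have "(LINT r|M. ?s i r) = (1 / norm (Y i - u)) *\<^sub>R
     ((LINT r|M. f (Y i) r) - ((LINT r|M. f u r) + (Y i - u) *\<^sub>R (LINT r|M. f' r)))" for i
      using int[OF Y(3)] int[of u] \<open>0 < \<delta>\<close> f'_int by simp
    ultimately have "(\<lambda>i. (1 / norm (Y i - u)) *\<^sub>R
     ((LINT r|M. f (Y i) r) - ((LINT r|M. f u r) + (Y i - u) *\<^sub>R (LINT r|M. f' r)))) \<longlonglongrightarrow> 0"
      by (simp only: Bochner_Integration.integral_zero)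
    then show "((\<lambda>y. (1 / norm (y - u)) *\<^sub>R
     ((LINT r|M. f y r) - ((LINT r|M. f u r) + (y - u) *\<^sub>R (LINT r|M. f' r)))) \<circ> X) \<longlonglongrightarrow> 0"
      unfolding Y_def o_def by (rule LIMSEQ_offset)
  qed
  then show ?thesis
    unfolding has_vector_derivative_def has_derivative_within
    by (auto intro: bounded_linear_scaleR_left)
qed

text \<open>A measure on the open half-line, so that positivity of \<open>r\<close> holds at every
  point of the space and \<open>r powr s\<close> is smooth there.\<close>

definition halfline :: "real measure" where
  "halfline = restrict_space lborel {0<..}"

lemma space_halfline [simp]: "space halfline = {0<..}"
  by (simp add: halfline_def space_restrict_space)

lemma borel_measurable_halfline: "f \<in> borel_measurable borel \<Longrightarrow> f \<in> borel_measurable halfline"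
  unfolding halfline_def by (rule measurable_restrict_space1) simp

lemma integrable_halfline:
  fixes f :: "real \<Rightarrow> 'b::{banach, second_countable_topology}"
  shows "integrable halfline f \<longleftrightarrow> set_integrable lborel {0<..} f"
  unfolding halfline_def set_integrable_def by (rule integrable_restrict_space) simp

lemma integral_halfline:
  fixes f :: "real \<Rightarrow> 'b::{banach, second_countable_topology}"
  shows "integral\<^sup>L halfline f = (LINT x:{0<..}|lborel. f x)"
  unfolding halfline_def set_lebesgue_integral_def by (rule integral_restrict_space) simp

text \<open>For nonnegative functions gauge integrability, in which the facts on powers and on the
  Gamma integral are available, gives Lebesgue integrability.\<close>

lemma integrable_halfline_nonneg:
  fixes f :: "real \<Rightarrow> real"
  assumes [measurable]: "f \<in> borel_measurable borel" and "\<And>x. 0 < x \<Longrightarrow> 0 \<le> f x" "f integrable_on {0<..}"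
  shows "integrable halfline f"
proof -
  have "f absolutely_integrable_on {0<..}"
    using assms by (intro nonnegative_absolutely_integrable_1) auto
  then have "integrable lebesgue (\<lambda>x. indicator {0<..} x *\<^sub>R f x)"
    by (simp add: set_integrable_def)
  then show ?thesis
    unfolding integrable_halfline set_integrable_def
    by (subst (asm) integrable_completion) auto
qed

text \<open>The integrand is the norm of the complex Gamma integrand, whose absolute integrability
  is known.\<close>

lemma integrable_Gamma_real:
  fixes s l :: real
  assumes "0 < s" "0 < l"
  shows "integrable halfline (\<lambda>r. r powr (s - 1) * exp (- (l * r)))"
proof -
  have "(\<lambda>t. complex_of_real t powr (of_real s - 1) / of_real (exp (l * t)))
             absolutely_integrable_on {0<..}"
    using absolutely_integrable_Gamma_integral[of "of_real s" l] assms by simp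
  then have "(\<lambda>t. norm (complex_of_real t powr (of_real s - 1) / of_real (exp (l * t)))) integrable_on {0<..}"
    by (simp add: absolutely_integrable_on_def)
  also have "?this \<longleftrightarrow> (\<lambda>r. r powr (s - 1) * exp (- (l * r))) integrable_on {0<..}"
    by (intro integrable_cong) (auto simp: norm_mult norm_inverse norm_powr_real_powr exp_minus divide_inverse)
  finally show ?thesis by (intro integrable_halfline_nonneg) auto
qed

lemma integral_Gamma_real:
  fixes s l :: real
  assumes "0 < s" "0 < l"
  shows "(LINT r|halfline. r powr (s - 1) * exp (- (l * r))) = Gamma s / l powr s"
proof -
  have int: "integrable halfline (\<lambda>r. r powr (s - 1) * exp (- r))"
    using integrable_Gamma_real[of s 1] assms by simp
  have "((\<lambda>t. t powr (s - 1) / exp t) has_integral Gamma s) {0<..}"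
    using Gamma_integral_real[OF assms(1)]
    by (subst has_integral_spike_set_eq[of _ "{0..}"]) (auto intro: negligible_subset[of "{0}"])
  then have "((\<lambda>t. t powr (s - 1) * exp (- t)) has_integral Gamma s) {0<..}"
    by (simp add: exp_minus divide_inverse)
  moreover have "((\<lambda>t. t powr (s - 1) * exp (- t)) has_integral
      (LINT r|halfline. r powr (s - 1) * exp (- r))) {0<..}"
    using int unfolding integral_halfline integrable_halfline
    using set_borel_integral_eq_integral[of "{0<..}" "\<lambda>r. r powr (s - 1) * exp (- r)"]
    by (auto simp: has_integral_integral)
  ultimately have *: "(LINT r|halfline. r powr (s - 1) * exp (- r)) = Gamma s"
    by (rule has_integral_unique[symmetric])
  \<comment> \<open>Substitution \<open>r \<mapsto> l * r\<close>; it contributes the factor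
    \<open>l * l powr (s - 1) = l powr s\<close>.\<close>
  have "(LINT r|halfline. r powr (s - 1) * exp (- r)) =
      \<bar>l\<bar> *\<^sub>R (LINT r|lborel. indicator {0<..} (0 + l * r) *\<^sub>R ((0 + l * r) powr (s - 1) * exp (- (0 + l * r))))"
    unfolding integral_halfline set_lebesgue_integral_def
    by (rule lborel_integral_real_affine) (use assms in auto)
  also have "\<dots> = l * (LINT r|lborel. l powr (s - 1) * (indicator {0<..} r *\<^sub>R (r powr (s - 1) * exp (- (l * r)))))"
  proof -
    have "indicator {0<..} (0 + l * r) *\<^sub>R ((0 + l * r) powr (s - 1) * exp (- (0 + l * r)))
        = l powr (s - 1) * (indicator {0<..} r *\<^sub>R (r powr (s - 1) * exp (- (l * r))))" for r
      using assms by (simp add: indicator_def zero_less_mult_iff powr_mult)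
    then show ?thesis using assms by (simp only: integral_mult_right_zero) simp
  qed
  also have "\<dots> = l * l powr (s - 1) * (LINT r|halfline. r powr (s - 1) * exp (- (l * r)))"
    unfolding integral_halfline set_lebesgue_integral_def by simp
  also have "l * l powr (s - 1) = l powr s" using assms by (simp add: powr_diff)
  finally show ?thesis using * assms by (simp add: field_simps)
qed

section \<open>The Gamma integral with complex rate\<close>

lemma norm_exp_i_minus_1_le: "norm (exp (\<i> * complex_of_real x) - 1) \<le> \<bar>x\<bar>"
  using abs_sin_x_le_abs_x[of "x / 2"] by (simp add: dist_exp_i_1)

lemma norm_exp_i_minus_1_le_2: "norm (exp (\<i> * complex_of_real x) - 1) \<le> 2"
  using norm_triangle_ineq4[of "exp (\<i> * complex_of_real x)" 1] by simp

lemma norm_exp_i_diff_le: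
  "norm (exp (\<i> * complex_of_real x) - exp (\<i> * complex_of_real y)) \<le> \<bar>x - y\<bar>"
proof -
  have "exp (\<i> * complex_of_real x) - exp (\<i> * complex_of_real y)
      = exp (\<i> * complex_of_real y) * (exp (\<i> * complex_of_real (x - y)) - 1)"
    by (simp add: algebra_simps flip: exp_add)
  then show ?thesis
    using norm_exp_i_minus_1_le[of "x - y"] by (simp add: norm_mult)
qed

lemma exp_i_vector_derivative:
  "((\<lambda>v. exp (\<i> * complex_of_real (v * r))) has_vector_derivative
     \<i> * of_real r * exp (\<i> * complex_of_real (u * r))) (at u within S)"
proof -
  have "((\<lambda>z. exp (\<i> * (z * of_real r))) has_field_derivative
      \<i> * of_real r * exp (\<i> * (of_real u * of_real r))) (at (complex_of_real u))"
    by (auto intro!: derivative_eq_intros)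
  from has_vector_derivative_real_field[OF this, of S] show ?thesis by simp
qed

lemma gamma_bound_integral:
  fixes s l u :: real
  assumes "0 < s" "0 < l"
  shows "integrable halfline
     (\<lambda>r. complex_of_real (r powr (s - 1) * exp (- (l * r))) * exp (\<i> * of_real (u * r)))"
  by (rule Bochner_Integration.integrable_bound[OF integrable_Gamma_real[OF assms]])
     (auto intro!: borel_measurable_halfline simp: norm_mult)

text \<open>Integration by parts, in the form that the derivative of
  \<open>r powr s * exp (- z * r)\<close> with \<open>z = l - \<i> * u\<close> integrates to 0: the
  boundary values vanish at 0 because s > 0 and at infinity because l > 0.\<close>

lemma gamma_recursion:
  fixes s l u :: real
  assumes "0 < s" "0 < l"
  defines "H \<equiv> \<lambda>s. LINT r|halfline.
     complex_of_real (r powr (s - 1) * exp (- (l * r))) * exp (\<i> * of_real (u * r))"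
  shows "(of_real l - \<i> * of_real u) * H (s + 1) = of_real s * H s"
proof -
  let ?z = "of_real l - \<i> * of_real u :: complex"
  let ?h = "\<lambda>s r. complex_of_real (r powr (s - 1) * exp (- (l * r))) * exp (\<i> * of_real (u * r))"
  let ?F = "\<lambda>r. complex_of_real (r powr s) * exp (- (?z * of_real r))"
  let ?f = "\<lambda>r. of_real s * ?h s r - ?z * ?h (s + 1) r"
  have E: "complex_of_real (exp (- (l * r))) * exp (\<i> * of_real (u * r)) = exp (- (?z * of_real r))" for r
    by (simp add: exp_of_real[symmetric] algebra_simps flip: exp_add)
  have f_eq: "?f r = of_real (s * r powr (s - 1)) * exp (- (?z * of_real r))
      + of_real (r powr s) * (- ?z * exp (- (?z * of_real r)))" for r
    unfolding E[symmetric] by (simp add: algebra_simps)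
  have int: "integrable halfline ?f"
    using gamma_bound_integral[of s l u] gamma_bound_integral[of "s + 1" l u] assms
    by (intro Bochner_Integration.integrable_diff integrable_mult_right) auto
  have "(LBINT r=0..\<infinity>. ?f r) = 0 - 0"
  proof (rule interval_integral_FTC_integrable[where F="?F"])
    fix r :: real assume "0 < ereal r" then have r: "0 < r" by (simp add: zero_ereal_def)
    have "((\<lambda>r. r powr s) has_real_derivative s * r powr (s - 1)) (at r)"
      using r by (auto intro!: derivative_eq_intros)
    then have 1: "((\<lambda>r. complex_of_real (r powr s)) has_vector_derivative of_real (s * r powr (s - 1))) (at r)"
      by (intro has_vector_derivative_of_real) (simp add: has_real_derivative_iff_has_vector_derivative)
    have "((\<lambda>w. exp (- (?z * w))) has_field_derivative - ?z * exp (- (?z * of_real r))) (at (complex_of_real r))"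
      by (auto intro!: derivative_eq_intros)
    from has_vector_derivative_mult[OF 1 has_vector_derivative_real_field[OF this]]
    show "(?F has_vector_derivative ?f r) (at r)"
      unfolding f_eq by (simp add: algebra_simps)
    show "isCont ?f r"
      using r by (intro continuous_intros) auto
  next
    show "set_integrable lborel (einterval 0 \<infinity>) ?f"
      using int by (simp add: integrable_halfline zero_ereal_def)
    have n: "norm (?F r) = r powr s * exp (- (l * r))" if "0 < r" for r
      using that by (simp add: norm_mult)
    have "eventually (\<lambda>r::real. 0 \<le> r) (at_right 0)"
      by (rule eventually_mono[OF eventually_at_right_less]) simp
    then have "((\<lambda>r. r powr s) \<longlongrightarrow> 0) (at_right 0)"
      using assms by (intro tendsto_zero_powrI[OF _ tendsto_const] tendsto_ident_at) auto
    from tendsto_mult[OF this tendsto_exp[OF tendsto_minus[OF tendsto_mult[OF tendsto_const tendsto_ident_at]]]]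
    have "((\<lambda>r. r powr s * exp (- (l * r))) \<longlongrightarrow> 0 * exp (- (l * 0))) (at_right 0)" .
    moreover have "eventually (\<lambda>r. norm (?F r) = r powr s * exp (- (l * r))) (at_right 0)"
      by (rule eventually_mono[OF eventually_at_right_less]) (rule n)
    ultimately have "((\<lambda>r. norm (?F r)) \<longlongrightarrow> 0) (at_right 0)"
      by (simp only: tendsto_cong mult_zero_left)
    then have "(?F \<longlongrightarrow> 0) (at_right 0)"
      by (rule tendsto_norm_zero_cancel)
    then show "((?F \<circ> real_of_ereal) \<longlongrightarrow> 0) (at_right 0)"
      by (simp add: ereal_tendsto_simps zero_ereal_def)
    have "((\<lambda>r. r powr s * exp (- (l * r))) \<longlongrightarrow> 0) at_top"
      using assms by real_asymp
    moreover have "eventually (\<lambda>r. norm (?F r) = r powr s * exp (- (l * r))) at_top"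
      by (rule eventually_mono[OF eventually_gt_at_top]) (rule n)
    ultimately have "((\<lambda>r. norm (?F r)) \<longlongrightarrow> 0) at_top"
      by (simp only: tendsto_cong)
    then have "(?F \<longlongrightarrow> 0) at_top"
      by (rule tendsto_norm_zero_cancel)
    then show "((?F \<circ> real_of_ereal) \<longlongrightarrow> 0) (at_left \<infinity>)"
      by (simp add: ereal_tendsto_simps)
  qed simp
  then have "integral\<^sup>L halfline ?f = 0"
    by (simp add: interval_lebesgue_integral_def integral_halfline zero_ereal_def)
  then show ?thesis
    unfolding H_def using gamma_bound_integral[of s l u] gamma_bound_integral[of "s + 1" l u] assms
    by (subst (asm) Bochner_Integration.integral_diff) auto
qed

text \<open>The hypotheses keep the base off 0 and the negative real axis, so the principal branch
  is holomorphic around it.\<close>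

lemma powr_vector_derivative:
  fixes l u :: real and s :: complex
  assumes "0 < l \<or> u \<noteq> 0" "0 \<le> l"
  shows "((\<lambda>v. (of_real l - \<i> * of_real v) powr s) has_vector_derivative
     - \<i> * s * (of_real l - \<i> * of_real u) powr (s - 1)) (at u)"
proof -
  have "of_real l - \<i> * of_real u \<notin> \<real>\<^sub>\<le>\<^sub>0"
    using assms by (auto simp: complex_nonpos_Reals_iff)
  then have "((\<lambda>w. (of_real l - \<i> * w) powr s) has_field_derivative
      - \<i> * s * (of_real l - \<i> * of_real u) powr (s - 1)) (at (complex_of_real u))"
    by (auto intro!: derivative_eq_intros)
  from has_vector_derivative_real_field[OF this] show ?thesis .
qed

text \<open>As a function of \<open>u\<close>, \<open>H s\<close> has derivative
  \<open>\<i> * H (s + 1) u\<close>, which \<open>gamma_recursion\<close> expresses through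
  \<open>H s u\<close> itself. This is a linear differential equation with solution a constant times
  \<open>z u powr (- s)\<close>; the constant is read off at \<open>u = 0\<close>, where the rate is
  real.\<close>

lemma gamma_integral_complex_rate:
  fixes s l u :: real
  assumes "0 < s" "0 < l"
  shows "(LINT r|halfline. complex_of_real (r powr (s - 1) * exp (- (l * r))) * exp (\<i> * of_real (u * r)))
     = of_real (Gamma s) * (of_real l - \<i> * of_real u) powr (- of_real s)"
proof -
  define H where "H \<equiv> \<lambda>s u. LINT r|halfline.
     complex_of_real (r powr (s - 1) * exp (- (l * r))) * exp (\<i> * of_real (u * r))"
  define z where "z \<equiv> \<lambda>u. complex_of_real l - \<i> * of_real u"
  have z0: "z u \<noteq> 0" for u using assms by (auto simp: z_def complex_eq_iff)
  have H': "(H s has_vector_derivative \<i> * H (s + 1) u) (at u)" for u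
  proof -
    have "(H s has_vector_derivative (LINT r|halfline. \<i> * 
      (complex_of_real (r powr (s + 1 - 1) * exp (- (l * r))) * exp (\<i> * of_real (u * r))))) (at u)"
      unfolding H_def
    \<comment> \<open>A derivative in \<open>u\<close> brings down a factor of modulus
      \<open>r\<close>, so the exponent rises by one; writing \<open>s + 1 - 1\<close> keeps the
      shape of \<open>H (s + 1)\<close>.\<close>
    proof (rule has_vector_derivative_integral[where \<delta>=1 and g="\<lambda>r. r powr (s + 1 - 1) * exp (- (l * r))"])
      show "integrable halfline (\<lambda>r. r powr (s + 1 - 1) * exp (- (l * r)))"
        using assms by (intro integrable_Gamma_real) auto
      show "integrable halfline (\<lambda>r. complex_of_real (r powr (s - 1) * exp (- (l * r))) * exp (\<i> * of_real (v * r)))" for v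
        using assms by (intro gamma_bound_integral)
      fix r assume r: "r \<in> space halfline"
      have p: "r * r powr (s - 1) = r powr s" using r by (simp add: powr_diff)
      have p': "complex_of_real r * complex_of_real (r powr (s - 1)) = complex_of_real (r powr s)" 
        by (simp flip: of_real_mult add: p)
      show "((\<lambda>v. complex_of_real (r powr (s - 1) * exp (- (l * r))) * exp (\<i> * complex_of_real (v * r)))
        has_vector_derivative \<i> * (complex_of_real (r powr (s + 1 - 1) * exp (- (l * r))) * exp (\<i> * of_real (u * r)))) (at u)"
        by (rule has_vector_derivative_eq_rhs[OF has_vector_derivative_mult_right[OF exp_i_vector_derivative]])
          (simp flip: p' add: ac_simps)
      show "norm (complex_of_real (r powr (s - 1) * exp (- (l * r))) * exp (\<i> * of_real (v * r)) -
          complex_of_real (r powr (s - 1) * exp (- (l * r))) * exp (\<i> * of_real (u * r)))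
          \<le> \<bar>v - u\<bar> * (r powr (s + 1 - 1) * exp (- (l * r)))" for v
      proof -
        have "norm (exp (\<i> * complex_of_real (v * r)) - exp (\<i> * of_real (u * r))) \<le> \<bar>v - u\<bar> * r"
          using norm_exp_i_diff_le[of "v * r" "u * r"] r by (simp add: abs_mult flip: left_diff_distrib)
        then have "r powr (s - 1) * exp (- (l * r)) * norm (exp (\<i> * complex_of_real (v * r)) - exp (\<i> * of_real (u * r)))
            \<le> r powr (s - 1) * exp (- (l * r)) * (\<bar>v - u\<bar> * r)"
          by (intro mult_left_mono) auto
        then show ?thesis
          by (simp flip: right_diff_distrib p add: norm_mult ac_simps)
      qed
      show "norm (\<i> * (complex_of_real (r powr (s + 1 - 1) * exp (- (l * r))) * exp (\<i> * of_real (u * r))))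
          \<le> r powr (s + 1 - 1) * exp (- (l * r))"
        by (simp add: norm_mult)
    qed (auto intro!: borel_measurable_halfline)
    then show ?thesis by (simp add: H_def)
  qed
  \<comment> \<open>\<open>z u powr s\<close> is the integrating factor of the equation for
    \<open>H s\<close>.\<close>
  define Q where "Q \<equiv> \<lambda>u. H s u * z u powr of_real s"
  have "(Q has_vector_derivative 0) (at u within UNIV)" for u
  proof -
    have "(Q has_vector_derivative H s u * (- \<i> * of_real s * z u powr (of_real s - 1))
        + \<i> * H (s + 1) u * z u powr of_real s) (at u)"
      unfolding Q_def z_def
      by (intro has_vector_derivative_mult H' powr_vector_derivative) (use assms in auto)
    also have "H s u * (- \<i> * of_real s * z u powr (of_real s - 1)) + \<i> * H (s + 1) u * z u powr of_real s
       = \<i> * z u powr (of_real s - 1) * (z u * H (s + 1) u - of_real s * H s u)"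
      using z0[of u] by (simp add: powr_diff field_simps)
    also have "\<dots> = 0"
      using gamma_recursion[OF assms, of u] by (simp add: z_def H_def)
    finally show ?thesis by simp
  qed
  then obtain c where c: "\<And>u. Q u = c"
    using has_vector_derivative_zero_constant[of UNIV Q] by auto
  have "H s 0 = of_real (LINT r|halfline. r powr (s - 1) * exp (- (l * r)))"
    unfolding H_def by (subst integral_complex_of_real[symmetric]) simp
  then have "H s 0 = of_real (Gamma s) / of_real (l powr s)"
    using integral_Gamma_real[OF assms] by simp
  moreover have "z 0 powr of_real s = of_real (l powr s)"
    using assms by (simp add: z_def powr_of_real)
  ultimately have "Q 0 = of_real (Gamma s)"
    using assms by (simp add: Q_def)
  with c have "Q u = of_real (Gamma s)" by metis
  then show ?thesis
    using z0[of u] by (simp add: Q_def H_def z_def powr_minus field_simps)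
qed

section \<open>Regularized Gamma integrals\<close>

text \<open>
  The flag \<open>b\<close> tells whether the gradient term is present, i.e. whether \<open>\<beta> > 1\<close>: \<open>osc b\<close> is
  the symbol of the difference \<open>incr b\<close>, and both are bounded by multiples of \<open>weight b\<close>.
\<close>

definition weight :: "bool \<Rightarrow> real \<Rightarrow> real" where
  "weight b r = (if b then r else 1) * min 1 r"

definition osc :: "bool \<Rightarrow> real \<Rightarrow> complex" where
  "osc b x = exp (\<i> * of_real x) - 1 - of_bool b * (\<i> * of_real x)"

text \<open>Although \<beta> determines \<open>b\<close>, a separate argument lets case distinctions
  run on \<open>b\<close> and lets \<beta> > 1 with \<open>True\<close> reduce to
  \<open>\<beta> - 1\<close> with \<open>False\<close>. At \<beta> = 1 neither
  \<open>weight True\<close> nor \<open>weight False\<close> is integrable against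
  \<open>r powr (- 2)\<close>.\<close>

definition admissible :: "real \<Rightarrow> bool \<Rightarrow> bool" where
  "admissible \<beta> b \<longleftrightarrow> 0 < \<beta> \<and> \<beta> < 2 \<and> \<beta> \<noteq> 1 \<and> (b \<longleftrightarrow> 1 < \<beta>)"

lemma weight_nonneg: "0 \<le> r \<Longrightarrow> 0 \<le> weight b r"
  by (simp add: weight_def)

lemma weight_measurable [measurable]: "weight b \<in> borel_measurable borel"
  unfolding weight_def[abs_def] by measurable

lemma osc_measurable [measurable]: "osc b \<in> borel_measurable borel"
  unfolding osc_def[abs_def] by measurable

lemma weight_mono: "0 \<le> x \<Longrightarrow> x \<le> y \<Longrightarrow> weight b x \<le> weight b y"
  unfolding weight_def by (intro mult_mono) auto

text \<open>Each of the at most two factors of \<open>weight b\<close> grows by at most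
  \<open>1 + a\<close>; the square covers both values of \<open>b\<close>.\<close>

lemma weight_mult_le:
  assumes "0 \<le> a" "0 \<le> r"
  shows "weight b (a * r) \<le> (1 + a)\<^sup>2 * weight b r"
proof -
  have 1: "min 1 (a * r) \<le> (1 + a) * min 1 r"
    using assms mult_nonneg_nonneg[OF assms] by (auto simp: min_def algebra_simps)
  have "(1 + a)\<^sup>2 \<ge> 1 + a" using assms by (simp add: power2_eq_square algebra_simps)
  show ?thesis
  proof (cases b)
    case True
    have "a * r * min 1 (a * r) \<le> ((1 + a) * r) * ((1 + a) * min 1 r)"
      using assms 1 by (intro mult_mono mult_right_mono) auto
    then show ?thesis using True by (simp add: weight_def power2_eq_square mult_ac)
  next
    case False
    have "(1 + a) * min 1 r \<le> (1 + a)\<^sup>2 * min 1 r"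
      using assms \<open>(1 + a)\<^sup>2 \<ge> 1 + a\<close> by (intro mult_right_mono) auto
    with 1 show ?thesis using False by (simp add: weight_def)
  qed
qed

text \<open>Mean value inequality on the segment from 0 to \<open>x\<close>: the derivative of
  \<open>exp (\<i> * v)\<close> differs there from its value at 0 by at most
  \<open>\<bar>x\<bar>\<close>.\<close>

lemma norm_osc_True_le: "norm (osc True x) \<le> x\<^sup>2"
proof -
  \<comment> \<open>The factors \<open>* 1\<close> fit \<open>exp_i_vector_derivative\<close> at
    \<open>r = 1\<close>.\<close>
  have "norm (exp (\<i> * complex_of_real (x * 1)) - exp (\<i> * complex_of_real (0 * 1))
      - (x - 0) *\<^sub>R (\<i> * of_real 1 * exp (\<i> * complex_of_real (0 * 1)))) \<le> norm (x - 0) * \<bar>x\<bar>"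
  proof (rule vector_differentiable_bound_linearization[where S="closed_segment 0 x" and ?x0.0=0
        and f="\<lambda>v. exp (\<i> * complex_of_real (v * 1))"])
    show "((\<lambda>v. exp (\<i> * complex_of_real (v * 1))) has_vector_derivative
        \<i> * of_real 1 * exp (\<i> * complex_of_real (y * 1))) (at y within closed_segment 0 x)" for y
      by (rule exp_i_vector_derivative)
    fix y assume "y \<in> closed_segment 0 x"
    then have "\<bar>y\<bar> \<le> \<bar>x\<bar>" by (auto simp: closed_segment_eq_real_ivl split: if_splits)
    then show "norm (\<i> * of_real 1 * exp (\<i> * complex_of_real (y * 1)) -
        \<i> * of_real 1 * exp (\<i> * complex_of_real (0 * 1))) \<le> \<bar>x\<bar>"
      using norm_exp_i_minus_1_le[of y] by (simp add: norm_mult flip: right_diff_distrib_numeral right_diff_distrib)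
        (metis norm_mult norm_ii mult_1 right_diff_distrib mult.right_neutral order_trans)
  qed auto
  then show ?thesis
    by (simp add: osc_def power2_eq_square scaleR_conv_of_real mult_ac)
qed

lemma norm_osc_le: "norm (osc b x) \<le> 2 * weight b \<bar>x\<bar>"
proof (cases b)
  case True
  have "norm (osc True x) \<le> norm (exp (\<i> * of_real x) - 1) + norm (\<i> * complex_of_real x)"
    using norm_triangle_ineq4 by (simp add: osc_def)
  then have "norm (osc True x) \<le> 2 * \<bar>x\<bar>"
    using norm_exp_i_minus_1_le[of x] by (simp add: norm_mult)
  moreover have "norm (osc True x) \<le> 2 * (\<bar>x\<bar> * \<bar>x\<bar>)"
    using norm_osc_True_le[of x] zero_le_square[of x] unfolding power2_eq_square abs_mult_self_eq by linarith
  ultimately show ?thesis using True by (auto simp: weight_def min_def)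
next
  case False
  then show ?thesis using norm_exp_i_minus_1_le[of x] norm_exp_i_minus_1_le_2[of x]
    by (auto simp: weight_def min_def osc_def)
qed

text \<open>Near 0 the product is \<open>r powr (1 - \<beta>)\<close> if \<open>b\<close> and
  \<open>r powr (- \<beta>)\<close> otherwise; beyond 1 it is \<open>r powr (- \<beta>)\<close> and
  \<open>r powr (- 1 - \<beta>)\<close>. Both ends converge because \<open>b\<close> tells whether
  \<beta> exceeds 1.\<close>

lemma integrable_weight:
  assumes "admissible \<beta> b"
  shows "integrable halfline (\<lambda>r. weight b r * r powr (- 1 - \<beta>))"
proof (rule integrable_halfline_nonneg)
  let ?e = "if b then 1 else 0 :: real"
  have 1: "(\<lambda>r. r powr (?e - \<beta>)) integrable_on {0<..1}"
    using assms by (intro integrable_on_powr_from_0') (auto simp: admissible_def)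
  have "(\<lambda>r. weight b r * r powr (- 1 - \<beta>)) integrable_on {0<..1}"
    by (rule integrable_eq[OF 1]) (auto simp: weight_def powr_diff field_simps powr_minus powr_add)
  moreover have 2: "(\<lambda>r. r powr (?e - 1 - \<beta>)) integrable_on {1..}"
    using has_integral_powr_to_inf[of "?e - 1 - \<beta>" 1] assms
    by (auto simp: admissible_def integrable_on_def)
  have "(\<lambda>r. weight b r * r powr (- 1 - \<beta>)) integrable_on {1..}"
    by (rule integrable_eq[OF 2]) (auto simp: weight_def powr_diff field_simps powr_minus powr_add)
  ultimately have "(\<lambda>r. weight b r * r powr (- 1 - \<beta>)) integrable_on ({0<..1} \<union> {1..})"
    by (intro integrable_Un) (auto intro: negligible_subset[of "{1}"])
  also have "{0<..1} \<union> {1::real..} = {0<..}" by auto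
  finally show "(\<lambda>r. weight b r * r powr (- 1 - \<beta>)) integrable_on {0<..}" .
qed (auto simp: weight_nonneg)

text \<open>The exponential is bounded by 1, which makes the bound independent of \<open>l\<close>;
  it can therefore dominate the passage to rate 0.\<close>

lemma osc_radial_bound:
  assumes "0 \<le> l" "0 < r"
  shows "norm (osc b (u * r) * of_real (exp (- (l * r)) * r powr (- 1 - \<beta>)))
    \<le> 2 * (1 + \<bar>u\<bar>)\<^sup>2 * (weight b r * r powr (- 1 - \<beta>))"
proof -
  have "norm (osc b (u * r)) \<le> 2 * ((1 + \<bar>u\<bar>)\<^sup>2 * weight b r)"
    using norm_osc_le[of b "u * r"] weight_mult_le[of "\<bar>u\<bar>" r b] assms by (simp add: abs_mult)
  moreover have "exp (- (l * r)) * r powr (- 1 - \<beta>) \<le> 1 * r powr (- 1 - \<beta>)"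
    using assms by (intro mult_right_mono) auto
  ultimately have "norm (osc b (u * r)) * (exp (- (l * r)) * r powr (- 1 - \<beta>))
      \<le> 2 * ((1 + \<bar>u\<bar>)\<^sup>2 * weight b r) * (1 * r powr (- 1 - \<beta>))"
    using assms by (intro mult_mono) (auto simp: weight_nonneg)
  then show ?thesis by (simp add: norm_mult mult_ac)
qed

lemma integrable_osc_radial:
  assumes "admissible \<beta> b" "0 \<le> l"
  shows "integrable halfline (\<lambda>r. osc b (u * r) * of_real (exp (- (l * r)) * r powr (- 1 - \<beta>)))"
proof (rule Bochner_Integration.integrable_bound)
  show "integrable halfline (\<lambda>r. 2 * (1 + \<bar>u\<bar>)\<^sup>2 * (weight b r * r powr (- 1 - \<beta>)))"
    using integrable_weight[OF assms(1)] by simp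
  show "AE r in halfline. norm (osc b (u * r) * of_real (exp (- (l * r)) * r powr (- 1 - \<beta>)))
     \<le> norm (2 * (1 + \<bar>u\<bar>)\<^sup>2 * (weight b r * r powr (- 1 - \<beta>)))"
    using osc_radial_bound[OF assms(2)] by (intro AE_I2) (auto intro: order_trans[OF _ abs_ge_self])
qed (auto intro!: borel_measurable_halfline)

lemma has_vector_derivative_osc:
  "((\<lambda>v. osc b (v * r)) has_vector_derivative
     (\<i> * of_real r * (if b then osc False (u * r) else exp (\<i> * of_real (u * r))))) (at u within S)"
proof -
  have "((\<lambda>v. osc b (v * r)) has_vector_derivative
      \<i> * of_real r * exp (\<i> * complex_of_real (u * r)) - 0 - of_bool b * (\<i> * of_real (1 * r))) (at u within S)"
    unfolding osc_def
    by (intro has_vector_derivative_diff exp_i_vector_derivative has_vector_derivative_const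
        has_vector_derivative_mult_right has_vector_derivative_of_real derivative_eq_intros)
      (auto intro!: derivative_eq_intros)
  then show ?thesis
    by (rule has_vector_derivative_eq_rhs) (simp add: osc_def algebra_simps)
qed

lemma admissible_not_nonpos_Ints:
  assumes "admissible \<beta> b"
  shows "- \<beta> \<notin> \<int>\<^sub>\<le>\<^sub>0"
proof
  assume "- \<beta> \<in> \<int>\<^sub>\<le>\<^sub>0"
  then obtain i where "- \<beta> = of_int i" by (rule nonpos_Ints_cases)
  then have i: "\<beta> = of_int (- i)" by simp
  with assms have "real_of_int 0 < of_int (- i)" "real_of_int (- i) < of_int 2" "real_of_int (- i) \<noteq> of_int 1"
    by (auto simp: admissible_def)
  then have "0 < - i" "- i < 2" "- i \<noteq> 1"
    by (simp_all only: of_int_less_iff of_int_eq_iff)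
  then show False by simp
qed

text \<open>Differentiating in \<open>u\<close> raises the power of \<open>r\<close> by one, which reduces the regularized integrals
  to the Gamma integral with complex rate.\<close>

lemma osc_radial_integral_pos:
  assumes "admissible \<beta> b" "0 < l"
  shows "(LINT r|halfline. osc b (u * r) * of_real (exp (- (l * r)) * r powr (- 1 - \<beta>)))
    = of_real (Gamma (- \<beta>)) * ((of_real l - \<i> * of_real u) powr of_real \<beta> - of_real (l powr \<beta>)
        + of_bool b * (\<i> * of_real (u * \<beta> * l powr (\<beta> - 1))))"
proof -
  define J where "J b \<beta> u = (LINT r|halfline. osc b (u * r) * of_real (exp (- (l * r)) * r powr (- 1 - \<beta>)))"
    for b \<beta> u
  define G where "G b \<beta> u = of_real (Gamma (- \<beta>)) * ((of_real l - \<i> * of_real u) powr of_real \<beta> - of_real (l powr \<beta>)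
        + of_bool b * (\<i> * of_real (u * \<beta> * l powr (\<beta> - 1))))" for b \<beta> u
  have Gam: "Gamma (1 - \<beta>) = - \<beta> * Gamma (- \<beta>)" if "admissible \<beta> b" for \<beta> b
    using Gamma_plus1[of "- \<beta>"] admissible_not_nonpos_Ints[OF that] by simp
  \<comment> \<open>Both sides vanish at frequency 0, so equality of the derivatives is
    enough.\<close>
  have const: "J b \<beta> u = G b \<beta> u"
    if "\<And>u. (J b \<beta> has_vector_derivative D u) (at u)" "\<And>u. (G b \<beta> has_vector_derivative D u) (at u)" for b \<beta> D u
  proof -
    have "((\<lambda>u. J b \<beta> u - G b \<beta> u) has_vector_derivative 0) (at u within UNIV)" for u
      using has_vector_derivative_diff[OF that(1) that(2)] by simp
    then obtain c where c: "\<And>u. J b \<beta> u - G b \<beta> u = c"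
      using has_vector_derivative_zero_constant[of UNIV "\<lambda>u. J b \<beta> u - G b \<beta> u"] by auto
    have "J b \<beta> 0 = 0" "G b \<beta> 0 = 0"
      using assms by (auto simp: J_def G_def osc_def powr_of_real)
    with c have "c = 0" by (metis diff_zero)
    with c show ?thesis by (metis eq_iff_diff_eq_0)
  qed
  have G': "(G b \<beta> has_vector_derivative
      \<i> * of_real (Gamma (1 - \<beta>)) * ((of_real l - \<i> * of_real u) powr (of_real \<beta> - 1)
        - of_bool b * of_real (l powr (\<beta> - 1)))) (at u)" if "admissible \<beta> b" for b \<beta> u
  proof -
    have "(G b \<beta> has_vector_derivative of_real (Gamma (- \<beta>)) *
      (- \<i> * of_real \<beta> * (of_real l - \<i> * of_real u) powr (of_real \<beta> - 1) - 0 + of_bool b * (\<i> * of_real (1 * \<beta> * l powr (\<beta> - 1))))) (at u)"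
      unfolding G_def
      by (intro has_vector_derivative_mult_right has_vector_derivative_add has_vector_derivative_diff
          has_vector_derivative_const has_vector_derivative_of_real powr_vector_derivative)
        (use assms in \<open>auto intro!: derivative_eq_intros\<close>)
    then show ?thesis
      by (rule has_vector_derivative_eq_rhs) (simp add: Gam[OF that] algebra_simps)
  qed
  have J': "(J b \<beta> has_vector_derivative (LINT r|halfline. 
      (\<i> * of_real r * (if b then osc False (u * r) else exp (\<i> * of_real (u * r)))) * of_real (exp (- (l * r)) * r powr (- 1 - \<beta>)))) (at u)" 
    if "admissible \<beta> b" for b \<beta> u
    unfolding J_def
  \<comment> \<open>For \<open>b\<close>, the estimate
    \<open>norm (osc False (v * r)) \<le> (\<bar>u\<bar> + 1) * r\<close> on the unit ball around
    \<open>u\<close> gives the Gamma integrand with parameter \<open>2 - \<beta>\<close>; otherwise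
    the exponential is unimodular and the parameter is \<open>1 - \<beta>\<close>. Both are
    positive.\<close>
  proof (rule has_vector_derivative_integral[where \<delta>=1 and
        g="\<lambda>r. (if b then \<bar>u\<bar> + 1 else 1) * (r powr ((if b then 2 else 1) - \<beta> - 1) * exp (- (l * r)))"])
    let ?w = "\<lambda>r. exp (- (l * r)) * r powr (- 1 - \<beta>)"
    let ?d = "\<lambda>u r. \<i> * of_real r * (if b then osc False (u * r) else exp (\<i> * of_real (u * r)))"
    let ?g = "\<lambda>r. (if b then \<bar>u\<bar> + 1 else 1) * (r powr ((if b then 2 else 1) - \<beta> - 1) * exp (- (l * r)))"
    show "integrable halfline ?g"
      using integrable_Gamma_real[of "(if b then 2 else 1) - \<beta>" l] that assms(2)
      by (intro integrable_mult_right) (auto simp: admissible_def split: if_splits)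
    show "integrable halfline (\<lambda>r. osc b (v * r) * of_real (exp (- (l * r)) * r powr (- 1 - \<beta>)))" for v
      using that assms(2) by (intro integrable_osc_radial) auto
    show "((\<lambda>v. osc b (v * r) * of_real (?w r)) has_vector_derivative ?d u r * of_real (?w r)) (at u)" for r
      by (intro has_vector_derivative_mult_left has_vector_derivative_osc)
    have d: "norm (?d v r) * ?w r \<le> ?g r" if "0 < r" "\<bar>v - u\<bar> < 1" for v r
    proof -
      have "norm (?d v r) \<le> r * (if b then (\<bar>u\<bar> + 1) * r else 1)"
        using that norm_exp_i_minus_1_le[of "v * r"]
        by (auto simp: norm_mult osc_def abs_mult intro!: mult_left_mono elim!: order_trans)
      then have "norm (?d v r) * ?w r \<le> (r * (if b then (\<bar>u\<bar> + 1) * r else 1)) * ?w r"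
        by (intro mult_right_mono) auto
      also have "\<dots> = ?g r"
        using that by (auto simp: powr_diff powr_minus field_simps power2_eq_square powr_add)
      finally show ?thesis .
    qed
    show "norm (?d u r * of_real (?w r)) \<le> ?g r" if "r \<in> space halfline" for r
      using d[of r u] that by (simp add: norm_mult)
    show "norm (osc b (v * r) * of_real (?w r) - osc b (u * r) * of_real (?w r)) \<le> \<bar>v - u\<bar> * ?g r"
      if "r \<in> space halfline" "\<bar>v - u\<bar> < 1" for v r
    proof -
      have r: "0 < r" using that by simp
      have "norm (osc b (v * r) * of_real (?w r) - osc b (u * r) * of_real (?w r)) \<le> ?g r * norm (v - u)"
      \<comment> \<open>The Lipschitz estimate follows from the derivative bound \<open>d\<close> on
        the whole ball, for which \<open>d\<close> is stated for every \<open>v\<close> near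
        \<open>u\<close>.\<close>
      proof (rule differentiable_bound[where S="ball u 1" and f'="\<lambda>x h. h *\<^sub>R (?d x r * of_real (?w r))"])
        fix x assume x: "x \<in> ball u 1"
        have "((\<lambda>v. osc b (v * r) * of_real (?w r)) has_vector_derivative ?d x r * of_real (?w r)) (at x within ball u 1)"
          by (intro has_vector_derivative_mult_left has_vector_derivative_osc)
        then show "((\<lambda>v. osc b (v * r) * of_real (?w r)) has_derivative (\<lambda>h. h *\<^sub>R (?d x r * of_real (?w r)))) (at x within ball u 1)"
          by (simp add: has_vector_derivative_def)
        show "onorm (\<lambda>h. h *\<^sub>R (?d x r * of_real (?w r))) \<le> ?g r"
        proof (rule onorm_le)
          fix h :: real
          have "\<bar>h\<bar> * (norm (?d x r) * ?w r) \<le> \<bar>h\<bar> * ?g r"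
            using d[OF r, of x] x by (intro mult_left_mono) (auto simp: dist_real_def abs_minus_commute)
          then show "norm (h *\<^sub>R (?d x r * of_real (?w r))) \<le> ?g r * norm h"
            by (simp add: norm_mult mult_ac)
        qed
      qed (use that in \<open>auto simp: dist_real_def abs_minus_commute\<close>)
      then show ?thesis by (simp add: mult_ac)
    qed
    show "(\<lambda>r. ?d u r * of_real (?w r)) \<in> borel_measurable halfline"
      by (cases b) (auto intro!: borel_measurable_halfline)
  qed simp
  \<comment> \<open>For \<beta> < 1 the derivative is an ordinary Gamma integral with complex rate
    and parameter \<open>1 - \<beta> > 0\<close>.\<close>
  have False_case: "J False \<beta> u = G False \<beta> u" if "admissible \<beta> False" for \<beta> u
  proof (rule const[OF _ G'[OF that]])
    fix u
    have "(LINT r|halfline. (\<i> * of_real r * (if False then osc False (u * r) else exp (\<i> * of_real (u * r)))) * of_real (exp (- (l * r)) * r powr (- 1 - \<beta>)))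
      = (LINT r|halfline. \<i> * (complex_of_real (r powr ((1 - \<beta>) - 1) * exp (- (l * r))) * exp (\<i> * of_real (u * r))))"
    proof (rule Bochner_Integration.integral_cong)
      fix r assume "r \<in> space halfline"
      then have *: "r powr ((1 - \<beta>) - 1) = r * r powr (- 1 - \<beta>)" by (simp add: powr_diff powr_minus divide_inverse)
      show "(\<i> * of_real r * (if False then osc False (u * r) else exp (\<i> * of_real (u * r)))) * of_real (exp (- (l * r)) * r powr (- 1 - \<beta>))
       = \<i> * (complex_of_real (r powr ((1 - \<beta>) - 1) * exp (- (l * r))) * exp (\<i> * of_real (u * r)))"
        unfolding * by (simp add: mult_ac)
    qed simp
    also have "\<dots> = \<i> * of_real (Gamma (1 - \<beta>)) * ((of_real l - \<i> * of_real u) powr (of_real \<beta> - 1)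
        - of_bool False * of_real (l powr (\<beta> - 1)))"
      using gamma_integral_complex_rate[of "1 - \<beta>" l u] that assms(2) by (simp add: admissible_def mult_ac)
    finally show "(J False \<beta> has_vector_derivative
      \<i> * of_real (Gamma (1 - \<beta>)) * ((of_real l - \<i> * of_real u) powr (of_real \<beta> - 1)
        - of_bool False * of_real (l powr (\<beta> - 1)))) (at u)"
      using J'[OF that, of u] by simp
  qed
  \<comment> \<open>For \<beta> > 1 the derivative is \<open>\<i>\<close> times the regularized
    integral for \<open>\<beta> - 1\<close>, to which \<open>False_case\<close> applies; its Gamma
    factor \<open>Gamma (- (\<beta> - 1))\<close> is \<open>Gamma (1 - \<beta>)\<close>.\<close>
  have True_case: "J True \<beta> u = G True \<beta> u" if "admissible \<beta> True" for \<beta> u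
  proof (rule const[OF _ G'[OF that]])
    fix u
    have a: "admissible (\<beta> - 1) False" using that by (auto simp: admissible_def)
    have "(LINT r|halfline. (\<i> * of_real r * (if True then osc False (u * r) else exp (\<i> * of_real (u * r)))) * of_real (exp (- (l * r)) * r powr (- 1 - \<beta>)))
      = (LINT r|halfline. \<i> * (osc False (u * r) * of_real (exp (- (l * r)) * r powr (- 1 - (\<beta> - 1)))))"
    proof (rule Bochner_Integration.integral_cong)
      fix r assume "r \<in> space halfline"
      then have *: "r powr (- 1 - (\<beta> - 1)) = r * r powr (- 1 - \<beta>)" by (simp add: powr_diff powr_minus divide_inverse)
      show "(\<i> * of_real r * (if True then osc False (u * r) else exp (\<i> * of_real (u * r)))) * of_real (exp (- (l * r)) * r powr (- 1 - \<beta>))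
       = \<i> * (osc False (u * r) * of_real (exp (- (l * r)) * r powr (- 1 - (\<beta> - 1))))"
        unfolding * by (simp add: mult_ac)
    qed simp
    also have "\<dots> = \<i> * J False (\<beta> - 1) u"
      by (simp add: J_def)
    also have "\<dots> = \<i> * of_real (Gamma (1 - \<beta>)) * ((of_real l - \<i> * of_real u) powr (of_real \<beta> - 1)
        - of_bool True * of_real (l powr (\<beta> - 1)))"
      unfolding False_case[OF a] by (simp add: G_def)
    finally show "(J True \<beta> has_vector_derivative
      \<i> * of_real (Gamma (1 - \<beta>)) * ((of_real l - \<i> * of_real u) powr (of_real \<beta> - 1)
        - of_bool True * of_real (l powr (\<beta> - 1)))) (at u)"
      using J'[OF that, of u] by simp
  qed
  show ?thesis
    using False_case[of \<beta> u] True_case[of \<beta> u] assms(1) by (cases b) (auto simp: J_def G_def)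
qed

text \<open>For \<open>u \<noteq> 0\<close> the base \<open>- \<i> * u\<close> avoids the branch
  cut, so the closed form is continuous as the rate decreases to 0; the integral converges along
  with it by the bound independent of \<open>l\<close>.\<close>

lemma osc_radial_integral:
  assumes "admissible \<beta> b" "0 \<le> l"
  shows "(LINT r|halfline. osc b (u * r) * of_real (exp (- (l * r)) * r powr (- 1 - \<beta>)))
    = of_real (Gamma (- \<beta>)) * ((of_real l - \<i> * of_real u) powr of_real \<beta> - of_real (l powr \<beta>)
        + of_bool b * (\<i> * of_real (u * \<beta> * l powr (\<beta> - 1))))"
proof (cases "l = 0 \<and> u \<noteq> 0")
  case False
  \<comment> \<open>At \<open>l = 0\<close>, \<open>u = 0\<close> both sides are 0, by
    \<open>0 powr \<beta> = 0\<close>.\<close>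
  then consider "0 < l" | "l = 0" "u = 0" using assms(2) by fastforce
  then show ?thesis
    using osc_radial_integral_pos[OF assms(1)] by cases (auto simp: osc_def)
next
  case True
  define X :: "nat \<Rightarrow> real" where "X n = inverse (real (Suc n))" for n
  have X: "X \<longlonglongrightarrow> 0" "0 < X n" for n
    unfolding X_def by (rule LIMSEQ_inverse_real_of_nat) simp
  let ?R = "\<lambda>l. of_real (Gamma (- \<beta>)) * ((of_real l - \<i> * of_real u) powr of_real \<beta> - of_real (l powr \<beta>)
        + of_bool b * (\<i> * of_real (u * \<beta> * l powr (\<beta> - 1))))"
  have "(\<lambda>n. LINT r|halfline. osc b (u * r) * of_real (exp (- (X n * r)) * r powr (- 1 - \<beta>)))
     \<longlonglongrightarrow> (LINT r|halfline. osc b (u * r) * of_real (exp (- (0 * r)) * r powr (- 1 - \<beta>)))"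
  proof (rule integral_dominated_convergence[where w="\<lambda>r. 2 * (1 + \<bar>u\<bar>)\<^sup>2 * (weight b r * r powr (- 1 - \<beta>))"])
    show "integrable halfline (\<lambda>r. 2 * (1 + \<bar>u\<bar>)\<^sup>2 * (weight b r * r powr (- 1 - \<beta>)))"
      using integrable_weight[OF assms(1)] by simp
    show "AE r in halfline. (\<lambda>n. osc b (u * r) * of_real (exp (- (X n * r)) * r powr (- 1 - \<beta>))) \<longlonglongrightarrow>
        osc b (u * r) * of_real (exp (- (0 * r)) * r powr (- 1 - \<beta>))"
      by (intro AE_I2 tendsto_intros X)
    show "AE r in halfline. norm (osc b (u * r) * of_real (exp (- (X n * r)) * r powr (- 1 - \<beta>)))
        \<le> 2 * (1 + \<bar>u\<bar>)\<^sup>2 * (weight b r * r powr (- 1 - \<beta>))" for n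
      using X(2)[of n] by (intro AE_I2 osc_radial_bound) auto
  qed (auto intro!: borel_measurable_halfline)
  then have "(\<lambda>n. ?R (X n)) \<longlonglongrightarrow>
      (LINT r|halfline. osc b (u * r) * of_real (exp (- (0 * r)) * r powr (- 1 - \<beta>)))"
    unfolding osc_radial_integral_pos[OF assms(1) X(2)] .
  moreover have "(\<lambda>n. ?R (X n)) \<longlonglongrightarrow> ?R 0"
  proof -
    have z: "(\<lambda>n. (of_real (X n) - \<i> * of_real u) powr of_real \<beta>) \<longlonglongrightarrow>
        (of_real 0 - \<i> * of_real u) powr (of_real \<beta> :: complex)"
      using True by (intro tendsto_powr_complex tendsto_intros X) (auto simp: complex_nonpos_Reals_iff)
    have p: "(\<lambda>n. X n powr c) \<longlonglongrightarrow> 0 powr c" if "0 < c" for c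
      using tendsto_zero_powrI[OF X(1) tendsto_const[of c]] X(2) that by (simp add: less_imp_le)
    \<comment> \<open>When the linear term is present its exponent \<open>\<beta> - 1\<close> is
      positive, so the term tends to its value with \<open>0 powr (\<beta> - 1) = 0\<close>.\<close>
    have "b \<Longrightarrow> 0 < \<beta> - 1" "0 < \<beta>" using assms(1) by (auto simp: admissible_def)
    then have "(\<lambda>n. (of_bool b :: complex) * (\<i> * of_real (u * \<beta> * X n powr (\<beta> - 1)))) \<longlonglongrightarrow>
        of_bool b * (\<i> * of_real (u * \<beta> * 0 powr (\<beta> - 1)))"
      by (cases b) (auto intro!: tendsto_intros p simp del: powr_0)
    from tendsto_mult[OF tendsto_const tendsto_add[OF tendsto_diff[OF z tendsto_of_real[OF p[OF \<open>0 < \<beta>\<close>]]] this]]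
    show ?thesis .
  qed
  ultimately have "(LINT r|halfline. osc b (u * r) * of_real (exp (- (0 * r)) * r powr (- 1 - \<beta>))) = ?R 0"
    by (rule LIMSEQ_unique)
  moreover have "l = 0" using True by simp
  ultimately show ?thesis by (simp only:)
qed

section \<open>Polar coordinates\<close>

text \<open>The surface measure before completion, from which product measures are formed;
  \<open>surface_measure\<close> is reached from it through almost everywhere equality.\<close>

definition sphere_measure :: "'a::euclidean_space measure" where
  "sphere_measure = scale_measure (of_nat DIM('a))
       (distr (restrict_space lborel (cball 0 1 - {0})) (restrict_space borel (sphere 0 1))
          (\<lambda>x. x /\<^sub>R norm x))"

lemma surface_measure_eq: "surface_measure = completion sphere_measure"
  by (simp add: surface_measure_def sphere_measure_def)

lemma space_sphere_measure [simp]: "space sphere_measure = sphere 0 1"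
  by (simp add: sphere_measure_def space_scale_measure space_restrict_space)

lemma sets_sphere_measure: "sets (sphere_measure :: 'a::euclidean_space measure) = sets (restrict_space borel (sphere 0 1))"
  by (simp add: sphere_measure_def)

lemma sets_sphere_measure_iff:
  "A \<in> sets (sphere_measure :: 'a::euclidean_space measure) \<longleftrightarrow> A \<in> sets borel \<and> A \<subseteq> sphere 0 1"
  unfolding sets_sphere_measure by (subst sets_restrict_space_iff) auto

lemma emeasure_sphere_measure:
  fixes A :: "'a::euclidean_space set"
  assumes "A \<in> sets sphere_measure"
  shows "emeasure sphere_measure A =
           of_nat DIM('a) * emeasure lborel {x. 0 < norm x \<and> norm x \<le> 1 \<and> x /\<^sub>R norm x \<in> A}"
  using emeasure_surface_measure[of A] assms
  by (simp add: surface_measure_eq sets_sphere_measure_iff)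

lemma borel_measurable_sphere_measure:
  "f \<in> borel_measurable borel \<Longrightarrow> f \<in> borel_measurable sphere_measure"
  unfolding measurable_cong_sets[OF sets_sphere_measure refl] by (rule measurable_restrict_space1)

lemma emeasure_cone_finite:
  fixes A :: "'a::euclidean_space set"
  shows "emeasure lborel {x::'a. 0 < norm x \<and> norm x \<le> 1 \<and> x /\<^sub>R norm x \<in> A} < \<infinity>"
proof -
  have "emeasure lborel {x::'a. 0 < norm x \<and> norm x \<le> 1 \<and> x /\<^sub>R norm x \<in> A} \<le> emeasure lborel (cball (0::'a) 1)"
    by (intro emeasure_mono) auto
  also have "\<dots> < \<infinity>" by (rule emeasure_lborel_cball_finite)
  finally show ?thesis .
qed

lemma finite_sphere_measure: "finite_measure (sphere_measure :: 'a::euclidean_space measure)"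
proof
  have "sphere 0 1 \<in> sets (sphere_measure :: 'a measure)"
    by (simp add: sets_sphere_measure_iff)
  then show "emeasure sphere_measure (space (sphere_measure :: 'a measure)) \<noteq> \<infinity>"
    using emeasure_cone_finite[of "sphere (0::'a) 1"]
    by (simp add: emeasure_sphere_measure ennreal_mult_eq_top_iff less_top)
qed

text \<open>The half-line sits in the density and not in the space, so the measurable sets are the
  Borel sets of the whole line.\<close>

definition radial_measure :: "nat \<Rightarrow> real measure" where
  "radial_measure n = density lborel (\<lambda>r. ennreal (indicator {0<..} r * r ^ (n - 1)))"

lemma sets_radial_measure [simp]: "sets (radial_measure n) = sets borel"
  by (simp add: radial_measure_def)

lemma space_radial_measure [simp]: "space (radial_measure n) = UNIV"
  by (simp add: radial_measure_def)

lemma sigma_finite_radial_measure: "sigma_finite_measure (radial_measure n)"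
  unfolding radial_measure_def by (subst sigma_finite_measure.sigma_finite_iff_density_finite[OF sigma_finite_lborel]) auto

lemma emeasure_radial_measure_atMost:
  assumes "0 < n"
  shows "emeasure (radial_measure n) {..a} = ennreal (max 0 a ^ n / n)"
proof -
  have "emeasure (radial_measure n) {..a} =
      (\<integral>\<^sup>+ r. ennreal (indicator {0<..} r * r ^ (n - 1)) * indicator {..a} r \<partial>lborel)"
    unfolding radial_measure_def by (rule emeasure_density) auto
  also have "\<dots> = (\<integral>\<^sup>+ r. ennreal (r ^ (n - 1)) * indicator {0..max 0 a} r \<partial>lborel)"
    by (rule nn_integral_cong_AE, rule AE_mp[OF AE_lborel_singleton[of 0]])
       (auto intro!: AE_I2 simp: indicator_def)
  also have "\<dots> = ennreal (max 0 a ^ n / n - 0 ^ n / n)"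
  proof (rule nn_integral_FTC_Icc[where F="\<lambda>r. r ^ n / n"])
    show "((\<lambda>r. r ^ n / n) has_real_derivative x ^ (n - 1)) (at x)" for x
      using assms by (auto intro!: derivative_eq_intros)
  qed auto
  finally show ?thesis using assms by (simp add: zero_power)
qed

text \<open>The set on the left is the image of the truncated unit cone under dilation by
  \<open>a\<close>, whose Jacobian is \<open>a ^ DIM('a)\<close>.\<close>

lemma emeasure_cone_scaled:
  fixes A :: "'a::euclidean_space set"
  assumes A: "A \<in> sets borel" and "0 < a"
  shows "emeasure lborel {x. x \<noteq> 0 \<and> x /\<^sub>R norm x \<in> A \<and> norm x \<le> a}
    = ennreal (a ^ DIM('a)) * emeasure lborel {x. 0 < norm x \<and> norm x \<le> 1 \<and> x /\<^sub>R norm x \<in> A}"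
proof -
  let ?C = "{x. 0 < norm x \<and> norm x \<le> 1 \<and> x /\<^sub>R norm x \<in> A}"
  let ?D = "{x. x \<noteq> 0 \<and> x /\<^sub>R norm x \<in> A \<and> norm x \<le> a}"
  have eq: "?D = (\<lambda>x. a *\<^sub>R x + 0) ` ?C"
  proof (intro equalityI subsetI)
    fix x assume x: "x \<in> ?D"
    then have "x /\<^sub>R a \<in> ?C" using \<open>0 < a\<close> by (auto simp: field_simps)
    moreover have "x = a *\<^sub>R (x /\<^sub>R a) + 0" using \<open>0 < a\<close> by simp
    ultimately show "x \<in> (\<lambda>x. a *\<^sub>R x + 0) ` ?C" by (rule rev_image_eqI)
  next
    fix x assume "x \<in> (\<lambda>x. a *\<^sub>R x + 0) ` ?C"
    then obtain y where y: "y \<in> ?C" "x = a *\<^sub>R y" by auto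
    have "x /\<^sub>R norm x = y /\<^sub>R norm y" using y(2) \<open>0 < a\<close> by simp
    moreover have "x \<noteq> 0" "norm x \<le> a" using y \<open>0 < a\<close> by (auto simp: mult_left_le)
    ultimately show "x \<in> ?D" using y(1) by simp
  qed
  have m[measurable]: "?C \<in> sets borel" "?D \<in> sets borel"
    using A by measurable
  have "emeasure lebesgue ?D = ennreal (\<bar>a\<bar> ^ DIM('a)) * emeasure lebesgue ?C"
    unfolding eq using emeasure_lebesgue_affine[of a 0 ?C] by (simp add: ennreal_power)
  then show ?thesis using \<open>0 < a\<close> m by simp
qed

text \<open>For fixed \<open>A\<close> both sides are measures in \<open>B\<close>, so half-lines
  \<open>{..a}\<close> suffice. There the factor \<open>DIM('a)\<close> of the surface measure
  cancels the denominator from integrating \<open>r ^ (DIM('a) - 1)\<close>, and the scaling of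
  cones remains.\<close>

lemma polar_emeasure:
  fixes A :: "'a::euclidean_space set"
  assumes A: "A \<in> sets sphere_measure" and B: "B \<in> sets borel"
  shows "emeasure sphere_measure A * emeasure (radial_measure DIM('a)) B =
    emeasure lborel {x. x \<noteq> 0 \<and> x /\<^sub>R norm x \<in> A \<and> norm x \<in> B}"
proof -
  have Ab[measurable]: "A \<in> sets borel" using A by (simp add: sets_sphere_measure_iff)
  let ?S = "{x. x \<noteq> 0 \<and> x /\<^sub>R norm x \<in> A}"
  let ?C = "{x. 0 < norm x \<and> norm x \<le> 1 \<and> x /\<^sub>R norm x \<in> A}"
  let ?M = "scale_measure (emeasure sphere_measure A) (radial_measure DIM('a))"
  let ?N = "distr (restrict_space lborel ?S) borel norm"
  have S[measurable]: "?S \<in> sets borel" by measurable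
  have N: "emeasure ?N B = emeasure lborel {x. x \<noteq> 0 \<and> x /\<^sub>R norm x \<in> A \<and> norm x \<in> B}"
    if "B \<in> sets borel" for B
  proof -
    have "emeasure ?N B = emeasure (restrict_space lborel ?S) (norm -` B \<inter> space (restrict_space lborel ?S))"
      by (rule emeasure_distr) (auto intro!: measurable_restrict_space1 that)
    also have "\<dots> = emeasure lborel (norm -` B \<inter> ?S)"
      by (subst emeasure_restrict_space) (auto simp: space_restrict_space)
    also have "norm -` B \<inter> ?S = {x. x \<noteq> 0 \<and> x /\<^sub>R norm x \<in> A \<and> norm x \<in> B}" by auto
    finally show ?thesis .
  qed
  have eq: "emeasure ?M {..a} = emeasure ?N {..a}" for a
  proof (cases "0 < a")
    case True
    have *: "real DIM('a) * (a ^ DIM('a) / real DIM('a)) = a ^ DIM('a)" by simp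
    have "emeasure ?M {..a} = of_nat DIM('a) * emeasure lborel ?C * ennreal (a ^ DIM('a) / DIM('a))"
      using True by (simp add: emeasure_sphere_measure[OF A] emeasure_radial_measure_atMost)
    also have "\<dots> = (ennreal (real DIM('a)) * ennreal (a ^ DIM('a) / DIM('a))) * emeasure lborel ?C"
      by (simp add: mult_ac ennreal_of_nat_eq_real_of_nat)
    also have "\<dots> = ennreal (a ^ DIM('a)) * emeasure lborel ?C"
      using True by (subst ennreal_mult[symmetric]) (simp_all only: *, auto)
    also have "\<dots> = emeasure ?N {..a}"
      using emeasure_cone_scaled[OF Ab True] by (simp add: N)
    finally show ?thesis .
  next
    case False
    then have "emeasure ?N {..a} = emeasure lborel ({}::'a set)"
    proof (subst N, goal_cases)
      case 2
      have "x = 0" if "norm x \<le> a" for x :: 'a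
        using that False unfolding norm_le_zero_iff[symmetric] by linarith
      then have "{x. x \<noteq> 0 \<and> x /\<^sub>R norm x \<in> A \<and> norm x \<in> {..a}} = {}" by auto
      then show ?case by (simp only:)
    qed simp
    then show ?thesis
      using False by (simp add: emeasure_radial_measure_atMost max_def)
  qed
  have "?M = ?N"
  proof (rule measure_eqI_generator_eq[where \<Omega>=UNIV and E="range atMost" and A="\<lambda>i. {..real i}"])
    show "Int_stable (range atMost :: real set set)"
      by (auto simp: Int_stable_def)
    show "sets ?M = sigma_sets UNIV (range atMost)" "sets ?N = sigma_sets UNIV (range atMost)"
      using arg_cong[OF borel_eq_atMost[where 'a=real], of sets] by simp_all
    show "(\<Union>i. {..real i}) = UNIV" using real_arch_simple by auto
    show "emeasure ?M {..real i} \<noteq> \<infinity>" for i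
      using finite_measure.emeasure_finite[OF finite_sphere_measure, of A]
      by (simp add: emeasure_radial_measure_atMost ennreal_mult_eq_top_iff)
  qed (use eq in auto)
  then have "emeasure ?M B = emeasure ?N B" by simp
  then show ?thesis using N[OF B] by simp
qed

lemma measurable_radial_measure: "measurable M (radial_measure n) = borel_measurable M"
  by (rule measurable_cong_sets) auto

lemma measurable_polar_mult:
  "(\<lambda>(\<phi>, r). r *\<^sub>R \<phi>) \<in> measurable (sphere_measure \<Otimes>\<^sub>M radial_measure n) (borel :: 'a::euclidean_space measure)"
proof -
  let ?P = "sphere_measure \<Otimes>\<^sub>M radial_measure n :: ('a \<times> real) measure"
  have "fst \<in> measurable ?P (sphere_measure :: 'a measure)" by (rule measurable_fst)
  from measurable_compose[OF this borel_measurable_sphere_measure[OF measurable_ident]]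
  have [measurable]: "fst \<in> borel_measurable ?P" by (simp add: id_def)
  have "snd \<in> measurable ?P (radial_measure n)" by (rule measurable_snd)
  then have [measurable]: "snd \<in> borel_measurable ?P" by (simp only: measurable_radial_measure)
  show ?thesis unfolding case_prod_beta' by measurable
qed

text \<open>Rectangles determine the product measure, so by \<open>polar_emeasure\<close> the map
  from \<open>x\<close> to its direction and norm carries Lebesgue measure off the origin to the
  product. Multiplication undoes this map, and the origin is a null set.\<close>

lemma lborel_polar:
  "(lborel :: 'a::euclidean_space measure) =
     distr (sphere_measure \<Otimes>\<^sub>M radial_measure DIM('a)) borel (\<lambda>(\<phi>, r). r *\<^sub>R \<phi>)"
proof -
  let ?P = "sphere_measure \<Otimes>\<^sub>M radial_measure DIM('a) :: ('a \<times> real) measure"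
  let ?L = "restrict_space lborel (- {0}) :: 'a measure"
  let ?f = "\<lambda>x::'a. (x /\<^sub>R norm x, norm x)"
  have space_L: "space ?L = - {0}" by (simp add: space_restrict_space)
  have f1: "(\<lambda>x. x /\<^sub>R norm x) \<in> measurable ?L sphere_measure"
    by (subst measurable_cong_sets[OF refl sets_sphere_measure], rule measurable_restrict_space2)
      (auto simp: space_L intro!: measurable_restrict_space1)
  have f: "?f \<in> measurable ?L ?P"
    by (intro measurable_Pair f1) (auto simp: measurable_radial_measure intro!: measurable_restrict_space1)
  note mul = measurable_polar_mult[where 'a='a and n="DIM('a)"]
  have "?P = distr ?L ?P ?f"
  proof (rule pair_measure_eqI)
    show "sigma_finite_measure (sphere_measure :: 'a measure)"
      by (rule finite_measure.axioms(1)[OF finite_sphere_measure])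
    show "sigma_finite_measure (radial_measure DIM('a))"
      by (rule sigma_finite_radial_measure)
    fix A B assume A: "A \<in> sets (sphere_measure :: 'a measure)" and B: "B \<in> sets (radial_measure DIM('a))"
    have "A \<times> B \<in> sets ?P" using A B by (rule pair_measureI)
    then have "emeasure (distr ?L ?P ?f) (A \<times> B) = emeasure ?L (?f -` (A \<times> B) \<inter> space ?L)"
      by (rule emeasure_distr[OF f])
    also have "\<dots> = emeasure lborel (?f -` (A \<times> B) \<inter> space ?L)"
      by (subst emeasure_restrict_space) (auto simp: space_restrict_space)
    also have "?f -` (A \<times> B) \<inter> space ?L = {x. x \<noteq> 0 \<and> x /\<^sub>R norm x \<in> A \<and> norm x \<in> B}"
      by (auto simp: space_L)
    finally show "emeasure sphere_measure A * emeasure (radial_measure DIM('a)) B = emeasure (distr ?L ?P ?f) (A \<times> B)"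
      using polar_emeasure[OF A, of B] B by simp
  qed simp
  then have "distr ?P borel (\<lambda>(\<phi>, r). r *\<^sub>R \<phi>) = distr (distr ?L ?P ?f) borel (\<lambda>(\<phi>, r). r *\<^sub>R \<phi>)"
    by simp
  also have "\<dots> = distr ?L borel (\<lambda>x. x)"
    by (subst distr_distr[OF mul f]) (auto intro!: distr_cong simp: space_L)
  also have "\<dots> = lborel"
  proof (rule measure_eqI)
    fix A :: "'a set" assume "A \<in> sets (distr ?L borel (\<lambda>x. x))"
    then have A: "A \<in> sets borel" by simp
    have "emeasure (distr ?L borel (\<lambda>x. x)) A = emeasure ?L (A \<inter> space ?L)"
      using A by (subst emeasure_distr) (auto intro!: measurable_restrict_space1)
    also have "\<dots> = emeasure lborel (A - {0})"
      by (subst emeasure_restrict_space) (auto simp: space_L Diff_eq)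
    also have "\<dots> = emeasure lborel A"
      using A by (intro emeasure_Diff_null_set) auto
    finally show "emeasure (distr ?L borel (\<lambda>x. x)) A = emeasure lborel A" .
  qed simp
  finally show ?thesis by simp
qed

section \<open>Integrals in polar coordinates\<close>

lemma nn_integral_radial:
  assumes [measurable]: "f \<in> borel_measurable borel"
  shows "(\<integral>\<^sup>+ r. f r \<partial>radial_measure n) = (\<integral>\<^sup>+ r. ennreal (r ^ (n - 1)) * f r \<partial>halfline)"
  unfolding radial_measure_def halfline_def
  by (subst nn_integral_density, simp, simp, subst nn_integral_restrict_space)
     (auto intro!: nn_integral_cong simp: indicator_def)

lemma integral_radial:
  fixes f :: "real \<Rightarrow> 'b::{banach, second_countable_topology}"
  assumes [measurable]: "f \<in> borel_measurable borel"
  shows "(LINT r|radial_measure n. f r) = (LINT r|halfline. r ^ (n - 1) *\<^sub>R f r)"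
  unfolding radial_measure_def halfline_def
  by (subst integral_density, simp, simp, simp, simp add: indicator_def, subst integral_restrict_space)
     (auto intro!: Bochner_Integration.integral_cong simp: indicator_def)

lemma nn_integral_polar:
  fixes f :: "'a::euclidean_space \<Rightarrow> ennreal"
  assumes [measurable]: "f \<in> borel_measurable borel"
  shows "(\<integral>\<^sup>+ x. f x \<partial>lborel) =
     (\<integral>\<^sup>+ \<phi>. (\<integral>\<^sup>+ r. ennreal (r ^ (DIM('a) - 1)) * f (r *\<^sub>R \<phi>) \<partial>halfline) \<partial>sphere_measure)"
proof -
  interpret sigma_finite_measure "radial_measure DIM('a)" by (rule sigma_finite_radial_measure)
  have "(\<integral>\<^sup>+ x. f x \<partial>lborel) = (\<integral>\<^sup>+ p. f (snd p *\<^sub>R fst p) \<partial>(sphere_measure \<Otimes>\<^sub>M radial_measure DIM('a)))"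
    by (subst lborel_polar, subst nn_integral_distr[OF measurable_polar_mult]) (auto simp: case_prod_beta')
  also have "\<dots> = (\<integral>\<^sup>+ \<phi>. (\<integral>\<^sup>+ r. f (r *\<^sub>R \<phi>) \<partial>radial_measure DIM('a)) \<partial>sphere_measure)"
    using measurable_compose[OF measurable_polar_mult assms, of "DIM('a)"]
    by (subst nn_integral_fst[symmetric]) (auto simp: case_prod_beta')
  finally show ?thesis by (subst (asm) nn_integral_radial) auto
qed

lemma
  fixes f :: "'a::euclidean_space \<Rightarrow> 'b::{banach, second_countable_topology}"
  assumes f: "integrable lborel f"
  shows integrable_polar: "integrable sphere_measure (\<lambda>\<phi>. LINT r|halfline. r ^ (DIM('a) - 1) *\<^sub>R f (r *\<^sub>R \<phi>))"
    and integral_polar: "(LINT x|lborel. f x) =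
      (LINT \<phi>|sphere_measure. LINT r|halfline. r ^ (DIM('a) - 1) *\<^sub>R f (r *\<^sub>R \<phi>))"
proof -
  interpret sphere: finite_measure "sphere_measure :: 'a measure" by (rule finite_sphere_measure)
  interpret radial: sigma_finite_measure "radial_measure DIM('a)" by (rule sigma_finite_radial_measure)
  interpret pair_sigma_finite "sphere_measure :: 'a measure" "radial_measure DIM('a)" ..
  let ?P = "sphere_measure \<Otimes>\<^sub>M radial_measure DIM('a) :: ('a \<times> real) measure"
  have [measurable]: "f \<in> borel_measurable borel" using f by simp
  have int: "integrable ?P (\<lambda>(\<phi>, r). f (r *\<^sub>R \<phi>))"
    using f by (subst (asm) lborel_polar, subst (asm) integrable_distr_eq[OF measurable_polar_mult])
      (auto simp: case_prod_beta')
  have eq: "(LINT r|radial_measure DIM('a). f (r *\<^sub>R \<phi>)) = (LINT r|halfline. r ^ (DIM('a) - 1) *\<^sub>R f (r *\<^sub>R \<phi>))" for \<phi>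
    by (rule integral_radial) measurable
  show "integrable sphere_measure (\<lambda>\<phi>. LINT r|halfline. r ^ (DIM('a) - 1) *\<^sub>R f (r *\<^sub>R \<phi>))"
    using integrable_fst[OF int] unfolding eq .
  have "(LINT x|lborel. f x) = (LINT p|?P. (\<lambda>(\<phi>, r). f (r *\<^sub>R \<phi>)) p)"
    by (subst lborel_polar, subst integral_distr[OF measurable_polar_mult]) (auto simp: case_prod_beta')
  also have "\<dots> = (LINT \<phi>|sphere_measure. LINT r|radial_measure DIM('a). f (r *\<^sub>R \<phi>))"
    by (rule integral_fst[OF int, symmetric])
  finally show "(LINT x|lborel. f x) =
      (LINT \<phi>|sphere_measure. LINT r|halfline. r ^ (DIM('a) - 1) *\<^sub>R f (r *\<^sub>R \<phi>))"
    unfolding eq .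
qed

section \<open>Decay of increments of Schwartz functions\<close>

text \<open>The head of the list is the outermost derivative, so an entry at the end differentiates
  \<open>p\<close> first; this yields closure of Schwartz functions under partial
  derivatives.\<close>

lemma iter_partial_append:
  "iter_partial (bs @ [i]) p = iter_partial bs (\<lambda>x. frechet_derivative p (at x) i)"
  by (induction bs) simp_all

lemma schwartz_partial:
  assumes "schwartz p" "i \<in> Basis"
  shows "schwartz (\<lambda>x. frechet_derivative p (at x) i)"
  unfolding schwartz_def
proof
  fix bs :: "'a list" assume "bs \<in> lists Basis"
  then have "bs @ [i] \<in> lists Basis" using assms(2) by simp
  with assms(1) show "(\<forall>x. iter_partial bs (\<lambda>x. frechet_derivative p (at x) i) differentiable at x) \<and>
        (\<forall>N::nat. bounded (range (\<lambda>x. norm x ^ N *\<^sub>R iter_partial bs (\<lambda>x. frechet_derivative p (at x) i) x)))"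
    unfolding schwartz_def iter_partial_append[symmetric] by blast
qed

lemma schwartz_differentiable: "schwartz p \<Longrightarrow> p differentiable at x"
  unfolding schwartz_def by (drule bspec[of _ _ "[]"]) auto

lemma schwartz_continuous: "schwartz p \<Longrightarrow> continuous_on UNIV p"
  by (meson schwartz_differentiable differentiable_imp_continuous_within continuous_at_imp_continuous_on)

lemma schwartz_measurable: "schwartz p \<Longrightarrow> p \<in> borel_measurable borel"
  by (rule borel_measurable_continuous_onI[OF schwartz_continuous])

text \<open>\<open>DIM('a) + 1\<close> is the least integer exponent that makes this function
  integrable.\<close>

definition decay :: "'a::euclidean_space \<Rightarrow> real" where
  "decay x = inverse ((1 + norm x) ^ (DIM('a) + 1))"

lemma decay_pos: "0 < decay x"
  unfolding decay_def by (intro positive_imp_inverse_positive zero_less_power add_pos_nonneg) auto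

lemma decay_nonneg: "0 \<le> decay x"
  using decay_pos[of x] by simp

lemma decay_le_1: "decay x \<le> 1"
  unfolding decay_def by (intro inverse_le_1_iff[THEN iffD2] disjI2 one_le_power) simp

lemma decay_measurable [measurable]: "decay \<in> borel_measurable borel"
  unfolding decay_def[abs_def] by measurable

text \<open>The triangle inequality gives \<open>1 + norm X \<le> 2 * (1 + norm (X - Y))\<close>;
  the constant is 2 raised to the exponent in \<open>decay\<close>.\<close>

lemma decay_shift:
  fixes X Y :: "'a::euclidean_space"
  assumes "norm Y \<le> 1"
  shows "decay (X - Y) \<le> 2 ^ (DIM('a) + 1) * decay X"
proof -
  have "norm X \<le> norm (X - Y) + norm Y"
    using norm_triangle_ineq[of "X - Y" Y] by simp
  then have "(1 + norm X) / 2 \<le> 1 + norm (X - Y)"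
    using assms norm_ge_zero[of "X - Y"] by argo
  then have "inverse ((1 + norm (X - Y)) ^ (DIM('a) + 1)) \<le> inverse (((1 + norm X) / 2) ^ (DIM('a) + 1))"
    by (intro le_imp_inverse_le power_mono zero_less_power) (auto intro: add_pos_nonneg)
  then show ?thesis
    by (simp add: decay_def power_divide field_simps)
qed

lemma schwartz_decay:
  fixes p :: "'a::euclidean_space \<Rightarrow> complex"
  assumes "schwartz p"
  obtains C where "0 \<le> C" "\<And>x. norm (p x) \<le> C * decay x"
proof -
  let ?N = "DIM('a) + 1"
  have b: "bounded (range (\<lambda>x. norm x ^ N *\<^sub>R p x))" for N
    using assms unfolding schwartz_def by (auto dest!: bspec[of _ _ "[]"])
  obtain C0 where C0: "\<And>x. norm (p x) \<le> C0"
    using b[of 0] by (auto simp: bounded_iff)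
  obtain C1 where C1: "\<And>x. norm x ^ ?N * norm (p x) \<le> C1"
    using b[of ?N] by (auto simp: bounded_iff)
  have C0': "0 \<le> C0" and C1': "0 \<le> C1"
    using order_trans[OF norm_ge_zero C0[of 0]] order_trans[OF _ C1[of 0]] by auto
  show ?thesis
  proof (rule that)
    show "0 \<le> 2 ^ ?N * (C0 + C1)" using C0' C1' by simp
    fix x :: 'a
    \<comment> \<open>Through \<open>1 + r \<le> 2 * max 1 r\<close>; hence the two seminorms with
      powers 0 and \<open>?N\<close> control the decay.\<close>
    have "(1 + norm x) ^ ?N \<le> 2 ^ ?N * (1 + norm x ^ ?N)"
    proof -
      have "(1 + norm x) ^ ?N \<le> (2 * max 1 (norm x)) ^ ?N" by (intro power_mono) auto
      also have "\<dots> = 2 ^ ?N * max 1 (norm x) ^ ?N" by (rule power_mult_distrib)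
      also have "max 1 (norm x) ^ ?N \<le> 1 + norm x ^ ?N"
        by (simp add: max_def)
      finally show ?thesis by simp
    qed
    then have "(1 + norm x) ^ ?N * norm (p x) \<le> 2 ^ ?N * (1 + norm x ^ ?N) * norm (p x)"
      by (rule mult_right_mono) simp
    also have "\<dots> = 2 ^ ?N * (norm (p x) + norm x ^ ?N * norm (p x))"
      by (simp only: mult.assoc distrib_right mult_1)
    also have "\<dots> \<le> 2 ^ ?N * (C0 + C1)"
      by (intro mult_left_mono add_mono C0 C1) simp
    finally have *: "(1 + norm x) ^ ?N * norm (p x) \<le> 2 ^ ?N * (C0 + C1)" .
    have "0 < (1 + norm x) ^ ?N" by (intro zero_less_power add_pos_nonneg) auto
    with * show "norm (p x) \<le> 2 ^ ?N * (C0 + C1) * decay x"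
      unfolding decay_def divide_inverse[symmetric] by (subst pos_le_divide_eq) (simp_all only: mult.commute)
  qed
qed

text \<open>In polar coordinates the integrand is at most \<open>inverse ((1 + r)\<^sup>2)\<close>,
  whose integral over the half-line is 1, and the sphere has finite measure.\<close>

lemma integrable_decay: "integrable lborel (decay :: 'a::euclidean_space \<Rightarrow> real)"
proof (rule integrableI_bounded)
  have le: "r ^ (DIM('a) - 1) * inverse ((1 + r) ^ (DIM('a) + 1)) \<le> inverse ((1 + r)\<^sup>2)" if "0 < r" for r :: real
  proof -
    have "r ^ (DIM('a) - 1) * (1 + r)\<^sup>2 \<le> (1 + r) ^ (DIM('a) - 1) * (1 + r)\<^sup>2"
      using that by (intro mult_right_mono power_mono) auto
    also have "\<dots> = (1 + r) ^ (DIM('a) + 1)"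
      using DIM_positive[where 'a='a] by (subst power_add[symmetric]) simp
    finally have "r ^ (DIM('a) - 1) * (1 + r)\<^sup>2 \<le> (1 + r) ^ (DIM('a) + 1)" .
    moreover have "a * inverse B \<le> inverse c" if "a * c \<le> B" "0 < B" "0 < c" for a B c :: real
      using that by (simp add: field_simps)
    ultimately show ?thesis using that by (simp only: zero_less_power add_pos_pos zero_less_one)
  qed
  have "(\<integral>\<^sup>+ r. ennreal (inverse ((1 + r)\<^sup>2)) * indicator {0..} r \<partial>lborel) = ennreal (0 - (- inverse (1 + 0)))"
  proof (rule nn_integral_FTC_atLeast[where F="\<lambda>r. - inverse (1 + r)"])
    show "((\<lambda>r. - inverse (1 + r)) has_real_derivative inverse ((1 + x)\<^sup>2)) (at x)" if "0 \<le> x" for x :: real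
      using that by (auto intro!: derivative_eq_intros simp: power2_eq_square)
    show "((\<lambda>r::real. - inverse (1 + r)) \<longlongrightarrow> 0) at_top"
      by real_asymp
  qed auto
  then have fin: "(\<integral>\<^sup>+ r. ennreal (inverse ((1 + r)\<^sup>2)) \<partial>halfline) \<le> 1"
    unfolding halfline_def
    by (subst nn_integral_restrict_space) (auto intro!: nn_integral_mono elim!: ord_le_eq_trans[rotated] simp: indicator_def)
  have "(\<integral>\<^sup>+ x. ennreal (norm (decay (x :: 'a))) \<partial>lborel) = (\<integral>\<^sup>+ \<phi>. (\<integral>\<^sup>+ r. ennreal (r ^ (DIM('a) - 1)) *
      ennreal (norm (decay (r *\<^sub>R \<phi> :: 'a))) \<partial>halfline) \<partial>sphere_measure)"
    by (rule nn_integral_polar) measurable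
  also have "\<dots> \<le> (\<integral>\<^sup>+ \<phi>. 1 \<partial>(sphere_measure :: 'a measure))"
  proof (rule nn_integral_mono)
    fix \<phi> :: 'a assume "\<phi> \<in> space sphere_measure"
    then have "(\<integral>\<^sup>+ r. ennreal (r ^ (DIM('a) - 1)) * ennreal (norm (decay (r *\<^sub>R \<phi> :: 'a))) \<partial>halfline)
       \<le> (\<integral>\<^sup>+ r. ennreal (inverse ((1 + r)\<^sup>2)) \<partial>halfline)"
      using le by (intro nn_integral_mono) (auto simp: decay_def abs_of_pos power_add simp flip: ennreal_mult intro!: ennreal_leI)
    with fin show "(\<integral>\<^sup>+ r. ennreal (r ^ (DIM('a) - 1)) * ennreal (norm (decay (r *\<^sub>R \<phi> :: 'a))) \<partial>halfline) \<le> 1"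
      by (rule order_trans[rotated])
  qed
  also have "\<dots> < \<infinity>"
    using finite_measure.emeasure_finite[OF finite_sphere_measure] by (simp add: less_top)
  finally show "(\<integral>\<^sup>+ x. ennreal (norm (decay (x :: 'a))) \<partial>lborel) < \<infinity>" .
qed measurable

lemma integrable_lborel_shift:
  fixes f :: "'a::euclidean_space \<Rightarrow> 'b::{banach, second_countable_topology}"
  assumes "integrable lborel f"
  shows "integrable lborel (\<lambda>x. f (x - c))"
proof -
  have [measurable]: "f \<in> borel_measurable borel" using assms by simp
  have "integrable (distr lborel borel ((+) (- c))) f" using assms by (simp only: lborel_distr_plus)
  then show ?thesis by (subst (asm) integrable_distr_eq) auto
qed

lemma integral_lborel_shift:
  fixes f :: "'a::euclidean_space \<Rightarrow> 'b::{banach, second_countable_topology}"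
  assumes [measurable]: "f \<in> borel_measurable borel"
  shows "(LINT x|lborel. f (x - c)) = (LINT x|lborel. f x)"
proof -
  have "(LINT x|lborel. f x) = (LINT x|distr lborel borel ((+) (- c)). f x)" by (simp only: lborel_distr_plus)
  also have "\<dots> = (LINT x|lborel. f (x - c))" by (subst integral_distr) auto
  finally show ?thesis by simp
qed

lemma schwartz_integrable:
  fixes p :: "'a::euclidean_space \<Rightarrow> complex"
  assumes "schwartz p" shows "integrable lborel p"
proof -
  obtain C where C: "0 \<le> C" "\<And>x. norm (p x) \<le> C * decay x" using schwartz_decay[OF assms] by blast
  have "integrable lborel (\<lambda>x::'a. C * decay x)"
    by (intro integrable_mult_right integrable_decay)
  then show ?thesis
    by (rule Bochner_Integration.integrable_bound)
      (use C in \<open>auto simp: schwartz_measurable[OF assms] intro: order_trans[OF _ abs_ge_self]\<close>)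
qed

section \<open>Taylor estimates with integrable decay\<close>

lemma frechet_derivative_eq_dot_grad:
  fixes p :: "'a::euclidean_space \<Rightarrow> complex"
  assumes "p differentiable at X"
  shows "frechet_derivative p (at X) = (\<lambda>v. dot_grad v p X)"
proof
  fix v
  have "linear (frechet_derivative p (at X))" using assms by (rule linear_frechet_derivative)
  from linear_sum[OF this, of "\<lambda>i. (v \<bullet> i) *\<^sub>R i" Basis] linear_scale[OF this]
  have "frechet_derivative p (at X) (\<Sum>i\<in>Basis. (v \<bullet> i) *\<^sub>R i) = dot_grad v p X"
    by (simp add: dot_grad_def)
  then show "frechet_derivative p (at X) v = dot_grad v p X" by (simp only: euclidean_representation)
qed

lemma schwartz_has_derivative:
  "schwartz p \<Longrightarrow> (p has_derivative (\<lambda>v. dot_grad v p X)) (at X)"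
  using schwartz_differentiable[of p X] frechet_derivative_eq_dot_grad[of p X]
  by (metis frechet_derivative_works)

lemma norm_sum_basis_le:
  fixes c :: "'a::euclidean_space \<Rightarrow> complex"
  assumes "\<And>i. i \<in> Basis \<Longrightarrow> norm (c i) \<le> B i"
  shows "norm (\<Sum>i\<in>Basis. (v \<bullet> i) *\<^sub>R c i) \<le> norm v * (\<Sum>i\<in>Basis. B i)"
proof -
  have "norm (\<Sum>i\<in>Basis. (v \<bullet> i) *\<^sub>R c i) \<le> (\<Sum>i\<in>Basis. norm v * B i)"
    using assms by (intro sum_norm_le) (auto intro!: mult_mono simp: Basis_le_norm)
  then show ?thesis by (simp add: sum_distrib_left)
qed

lemma schwartz_dot_grad_decay:
  fixes p :: "'a::euclidean_space \<Rightarrow> complex"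
  assumes "schwartz p"
  obtains C where "0 \<le> C" "\<And>v X. norm (dot_grad v p X) \<le> C * norm v * decay X"
proof -
  have "\<forall>i\<in>Basis. \<exists>C. 0 \<le> C \<and> (\<forall>x. norm (frechet_derivative p (at x) i) \<le> C * decay x)"
  proof
    fix i :: 'a assume i: "i \<in> Basis"
    obtain C where "0 \<le> C" "\<And>x. norm (frechet_derivative p (at x) i) \<le> C * decay x"
      using schwartz_decay[OF schwartz_partial[OF assms i]] by blast
    then show "\<exists>C. 0 \<le> C \<and> (\<forall>x. norm (frechet_derivative p (at x) i) \<le> C * decay x)" by blast
  qed
  from bchoice[OF this] obtain c where c: "\<And>i. i \<in> Basis \<Longrightarrow> 0 \<le> c i"
     "\<And>i x. i \<in> Basis \<Longrightarrow> norm (frechet_derivative p (at x) i) \<le> c i * decay x"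
    by blast
  have "norm (dot_grad v p X) \<le> norm v * (\<Sum>i\<in>Basis. c i * decay X)" for v X
    unfolding dot_grad_def using c(2) by (rule norm_sum_basis_le)
  then have "norm (dot_grad v p X) \<le> (\<Sum>i\<in>Basis. c i) * norm v * decay X" for v X
    by (simp add: sum_distrib_left sum_distrib_right mult_ac)
  then show thesis using that[of "\<Sum>i\<in>Basis. c i"] c(1) by (simp add: sum_nonneg)
qed

text \<open>Mean value inequality on the unit ball; \<open>decay_shift\<close> moves the decay of
  the gradient from intermediate points \<open>X - Z\<close> to \<open>X\<close> at the cost of a
  constant.\<close>

lemma schwartz_diff_decay:
  fixes p :: "'a::euclidean_space \<Rightarrow> complex"
  assumes "schwartz p"
  obtains C where "0 \<le> C" "\<And>X Y. norm Y \<le> 1 \<Longrightarrow> norm (p (X - Y) - p X) \<le> C * norm Y * decay X"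
proof -
  obtain C where C: "0 \<le> C" "\<And>v X. norm (dot_grad v p X) \<le> C * norm v * decay X"
    using schwartz_dot_grad_decay[OF assms] by blast
  show thesis
  proof (rule that)
    show "0 \<le> C * 2 ^ (DIM('a) + 1)" using C(1) by simp
    fix X Y :: 'a assume Y: "norm Y \<le> 1"
    have "norm (p (X - Y) - p (X - 0)) \<le> (C * 2 ^ (DIM('a) + 1) * decay X) * norm (Y - 0)"
    proof (rule differentiable_bound[where S="cball 0 1" and f="\<lambda>Z. p (X - Z)" and f'="\<lambda>Z h. dot_grad (- h) p (X - Z)"])
      fix Z :: 'a assume Z: "Z \<in> cball 0 1"
      have "((\<lambda>Z. X - Z) has_derivative (\<lambda>h. - h)) (at Z within cball 0 1)"
        by (auto intro!: derivative_eq_intros)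
      from has_derivative_compose[OF this schwartz_has_derivative[OF assms]]
      show "((\<lambda>Z. p (X - Z)) has_derivative (\<lambda>h. dot_grad (- h) p (X - Z))) (at Z within cball 0 1)" .
      show "onorm (\<lambda>h. dot_grad (- h) p (X - Z)) \<le> C * 2 ^ (DIM('a) + 1) * decay X"
      proof (rule onorm_le)
        fix h
        have "norm (dot_grad (- h) p (X - Z)) \<le> C * norm h * decay (X - Z)" using C(2)[of "- h"] by simp
        also have "\<dots> \<le> C * norm h * (2 ^ (DIM('a) + 1) * decay X)"
          using decay_shift[of Z X] Z C(1) by (intro mult_left_mono) auto
        finally show "norm (dot_grad (- h) p (X - Z)) \<le> C * 2 ^ (DIM('a) + 1) * decay X * norm h"
          by (simp only: mult_ac)
      qed
    qed (use Y in auto)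
    then show "norm (p (X - Y) - p X) \<le> C * 2 ^ (DIM('a) + 1) * norm Y * decay X"
      by (simp add: mult_ac)
  qed
qed

text \<open>The linear term turns the derivative of
  \<open>Z \<mapsto> p (X - Z) + dot_grad Z p X\<close> into a difference of gradients, which
  \<open>schwartz_diff_decay\<close>, applied to the partial derivatives, bounds linearly. The mean
  value inequality supplies the second factor \<open>norm Y\<close>.\<close>

lemma schwartz_diff2_decay:
  fixes p :: "'a::euclidean_space \<Rightarrow> complex"
  assumes "schwartz p"
  obtains C where "0 \<le> C"
    "\<And>X Y. norm Y \<le> 1 \<Longrightarrow> norm (p (X - Y) - p X + dot_grad Y p X) \<le> C * (norm Y)\<^sup>2 * decay X"
proof -
  have "\<forall>i\<in>Basis. \<exists>C. 0 \<le> C \<and> (\<forall>X Y. norm Y \<le> 1 \<longrightarrow>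
      norm (frechet_derivative p (at (X - Y)) i - frechet_derivative p (at X) i) \<le> C * norm Y * decay X)"
  proof
    fix i :: 'a assume i: "i \<in> Basis"
    obtain C where "0 \<le> C" "\<And>X Y. norm Y \<le> 1 \<Longrightarrow>
        norm (frechet_derivative p (at (X - Y)) i - frechet_derivative p (at X) i) \<le> C * norm Y * decay X"
      using schwartz_diff_decay[OF schwartz_partial[OF assms i]] by blast
    then show "\<exists>C. 0 \<le> C \<and> (\<forall>X Y. norm Y \<le> 1 \<longrightarrow>
        norm (frechet_derivative p (at (X - Y)) i - frechet_derivative p (at X) i) \<le> C * norm Y * decay X)" by blast
  qed
  from bchoice[OF this] obtain c where c: "\<And>i. i \<in> Basis \<Longrightarrow> 0 \<le> c i"
     "\<And>i X Y. i \<in> Basis \<Longrightarrow> norm Y \<le> 1 \<Longrightarrow>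
        norm (frechet_derivative p (at (X - Y)) i - frechet_derivative p (at X) i) \<le> c i * norm Y * decay X"
    by blast
  let ?C = "\<Sum>i\<in>Basis. c i"
  have C: "0 \<le> ?C" using c(1) by (rule sum_nonneg)
  show thesis
  proof (rule that[OF C])
    fix X Y :: 'a assume Y: "norm Y \<le> 1"
    have "norm ((p (X - Y) + dot_grad Y p X) - (p (X - 0) + dot_grad 0 p X)) \<le> (?C * norm Y * decay X) * norm (Y - 0)"
    \<comment> \<open>Radius \<open>norm Y\<close> rather than 1: the difference of gradients is
      then of order \<open>norm Y\<close> on the whole ball.\<close>
    proof (rule differentiable_bound[where S="cball 0 (norm Y)" and f="\<lambda>Z. p (X - Z) + dot_grad Z p X"
          and f'="\<lambda>Z h. dot_grad (- h) p (X - Z) + dot_grad h p X"])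
      fix Z :: 'a assume Z: "Z \<in> cball 0 (norm Y)"
      have "((\<lambda>Z. X - Z) has_derivative (\<lambda>h. - h)) (at Z within cball 0 (norm Y))"
        by (auto intro!: derivative_eq_intros)
      from has_derivative_compose[OF this schwartz_has_derivative[OF assms]]
      have "((\<lambda>Z. p (X - Z)) has_derivative (\<lambda>h. dot_grad (- h) p (X - Z))) (at Z within cball 0 (norm Y))" .
      moreover have "bounded_linear (\<lambda>Z. dot_grad Z p X)"
        using schwartz_has_derivative[OF assms] by (rule has_derivative_bounded_linear)
      ultimately show "((\<lambda>Z. p (X - Z) + dot_grad Z p X) has_derivative (\<lambda>h. dot_grad (- h) p (X - Z) + dot_grad h p X))
          (at Z within cball 0 (norm Y))"
        by (intro has_derivative_add) (auto intro: bounded_linear_imp_has_derivative)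
      show "onorm (\<lambda>h. dot_grad (- h) p (X - Z) + dot_grad h p X) \<le> ?C * norm Y * decay X"
      proof (rule onorm_le)
        fix h
        have "norm (frechet_derivative p (at X) i - frechet_derivative p (at (X - Z)) i) \<le> c i * norm Y * decay X"
          if "i \<in> Basis" for i
        proof -
          have "norm (frechet_derivative p (at X) i - frechet_derivative p (at (X - Z)) i) \<le> c i * norm Z * decay X"
            using c(2)[OF that, of Z X] Z Y by (simp add: norm_minus_commute)
          also have "\<dots> \<le> c i * norm Y * decay X"
            using Z c(1)[OF that] decay_nonneg by (intro mult_right_mono mult_left_mono) auto
          finally show ?thesis .
        qed
        then have "norm (\<Sum>i\<in>Basis. (h \<bullet> i) *\<^sub>R (frechet_derivative p (at X) i - frechet_derivative p (at (X - Z)) i))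
            \<le> norm h * (\<Sum>i\<in>Basis. c i * norm Y * decay X)"
          by (rule norm_sum_basis_le)
        then show "norm (dot_grad (- h) p (X - Z) + dot_grad h p X) \<le> ?C * norm Y * decay X * norm h"
          by (simp add: dot_grad_def scaleR_diff_right sum_subtractf sum_negf sum_distrib_left sum_distrib_right mult_ac)
      qed
    qed (use Y in auto)
    then show "norm (p (X - Y) - p X + dot_grad Y p X) \<le> ?C * (norm Y)\<^sup>2 * decay X"
      by (simp add: dot_grad_def mult_ac power2_eq_square algebra_simps)
  qed
qed

definition incr :: "bool \<Rightarrow> ('a::euclidean_space \<Rightarrow> complex) \<Rightarrow> 'a \<Rightarrow> 'a \<Rightarrow> complex" where
  "incr b p X Y = p (X - Y) - p X + of_bool b * dot_grad Y p X"

text \<open>Taylor estimates for \<open>norm Y \<le> 1\<close>, the triangle inequality beyond. The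
  term \<open>decay (X - Y)\<close> accounts for the translate of \<open>p\<close> when
  \<open>Y\<close> is large; its integral over \<open>X\<close> is the same for every
  \<open>Y\<close>.\<close>

lemma incr_bound:
  fixes p :: "'a::euclidean_space \<Rightarrow> complex"
  assumes "schwartz p"
  obtains C where "0 \<le> C" "\<And>X Y. norm (incr b p X Y) \<le> C * weight b (norm Y) * (decay X + decay (X - Y))"
proof -
  obtain C0 where C0: "0 \<le> C0" "\<And>X. norm (p X) \<le> C0 * decay X"
    using schwartz_decay[OF assms] by blast
  obtain C1 where C1: "0 \<le> C1" "\<And>v X. norm (dot_grad v p X) \<le> C1 * norm v * decay X"
    using schwartz_dot_grad_decay[OF assms] by blast
  obtain C2 where C2: "0 \<le> C2" "\<And>X Y. norm Y \<le> 1 \<Longrightarrow> norm (p (X - Y) - p X) \<le> C2 * norm Y * decay X"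
    using schwartz_diff_decay[OF assms] by blast
  obtain C3 where C3: "0 \<le> C3" "\<And>X Y. norm Y \<le> 1 \<Longrightarrow>
      norm (p (X - Y) - p X + dot_grad Y p X) \<le> C3 * (norm Y)\<^sup>2 * decay X"
    using schwartz_diff2_decay[OF assms] by blast
  let ?C = "C0 + C1 + C2 + C3"
  show thesis
  proof (rule that)
    show "0 \<le> ?C" using C0 C1 C2 C3 by simp
    fix X Y :: 'a
    let ?d = "decay X + decay (X - Y)"
    have d: "0 \<le> decay X" "0 \<le> decay (X - Y)" by (rule decay_nonneg)+
    show "norm (incr b p X Y) \<le> ?C * weight b (norm Y) * ?d"
    proof (cases "norm Y \<le> 1")
      case True
      have "norm (incr b p X Y) \<le> (if b then C3 else C2) * weight b (norm Y) * decay X"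
        using C2(2)[OF True, of X] C3(2)[OF True, of X] True by (simp add: incr_def weight_def power2_eq_square mult_ac)
      also have "\<dots> \<le> ?C * weight b (norm Y) * ?d"
        using C0(1) C1(1) C2(1) C3(1) d
        by (intro mult_mono mult_right_mono) (auto simp: weight_nonneg intro!: mult_nonneg_nonneg)
      finally show ?thesis .
    next
      case False
      then have w: "weight b (norm Y) = (if b then norm Y else 1)" by (simp add: weight_def)
      then have w1: "1 \<le> weight b (norm Y)" using False by simp
      have "norm (incr b p X Y) \<le> norm (p (X - Y)) + norm (p X) + norm (of_bool b * dot_grad Y p X)"
        unfolding incr_def by (intro order_trans[OF norm_triangle_ineq] add_mono norm_triangle_ineq4 order_refl)
      also have "norm (of_bool b * dot_grad Y p X) \<le> C1 * weight b (norm Y) * decay X"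
        using C1(2)[of Y X] C1(1) d w by (cases b) auto
      also have "norm (p (X - Y)) + norm (p X) \<le> C0 * ?d"
        using C0(2)[of X] C0(2)[of "X - Y"] by (simp add: distrib_left)
      also have "C0 * ?d \<le> C0 * weight b (norm Y) * ?d"
        using w1 C0(1) d mult_left_mono[OF w1 C0(1)] by (intro mult_right_mono) auto
      also have "C1 * weight b (norm Y) * decay X \<le> C1 * weight b (norm Y) * ?d"
        using d C1(1) w1 by (intro mult_left_mono) auto
      also have "C0 * weight b (norm Y) * ?d + C1 * weight b (norm Y) * ?d = (C0 + C1) * weight b (norm Y) * ?d"
        by (simp add: distrib_right)
      also have "\<dots> \<le> ?C * weight b (norm Y) * ?d"
        using w1 d C2(1) C3(1) by (intro mult_right_mono) auto
      finally show ?thesis by simp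
    qed
  qed
qed

section \<open>Fourier transform of integrated increments\<close>

lemma integrable_exp_mult:
  fixes p :: "'a::euclidean_space \<Rightarrow> complex"
  assumes "integrable lborel p"
  shows "integrable lborel (\<lambda>X. exp (\<i> * of_real (k \<bullet> X)) * p X)"
proof (rule Bochner_Integration.integrable_bound[OF assms])
  have [measurable]: "p \<in> borel_measurable borel" using assms by simp
  show "(\<lambda>X. exp (\<i> * of_real (k \<bullet> X)) * p X) \<in> borel_measurable lborel" by measurable
qed (simp add: norm_mult)

lemma fourier_eq_lborel:
  fixes p :: "'a::euclidean_space \<Rightarrow> complex"
  assumes [measurable]: "p \<in> borel_measurable borel"
  shows "fourier p k = (LINT X|lborel. exp (\<i> * of_real (k \<bullet> X)) * p X)"
  unfolding fourier_def by (rule integral_completion) measurable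

lemma fourier_shift:
  fixes p :: "'a::euclidean_space \<Rightarrow> complex"
  assumes [measurable]: "p \<in> borel_measurable borel"
  shows "(LINT X|lborel. exp (\<i> * of_real (k \<bullet> X)) * p (X - Y)) = exp (\<i> * of_real (k \<bullet> Y)) * fourier p k"
proof -
  have "(LINT X|lborel. exp (\<i> * of_real (k \<bullet> X)) * p (X - Y)) =
      (LINT X|lborel. exp (\<i> * of_real (k \<bullet> Y)) * (exp (\<i> * of_real (k \<bullet> (X - Y))) * p (X - Y)))"
    by (intro Bochner_Integration.integral_cong refl)
      (simp add: inner_diff_right algebra_simps flip: exp_add mult.assoc)
  also have "\<dots> = exp (\<i> * of_real (k \<bullet> Y)) * (LINT X|lborel. exp (\<i> * of_real (k \<bullet> (X - Y))) * p (X - Y))"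
    by simp
  also have "(LINT X|lborel. exp (\<i> * of_real (k \<bullet> (X - Y))) * p (X - Y)) = fourier p k"
    unfolding fourier_eq_lborel[OF assms]
    by (rule integral_lborel_shift[where f="\<lambda>X. exp (\<i> * of_real (k \<bullet> X)) * p X"]) measurable
  finally show ?thesis .
qed

lemma schwartz_dot_grad_measurable:
  assumes "schwartz p"
  shows "(\<lambda>X. dot_grad v p X) \<in> borel_measurable borel"
  unfolding dot_grad_def
  by (intro borel_measurable_sum borel_measurable_scaleR borel_measurable_const
      schwartz_measurable[OF schwartz_partial[OF assms]])

lemma schwartz_dot_grad_integrable:
  fixes p :: "'a::euclidean_space \<Rightarrow> complex"
  assumes "schwartz p"
  shows "integrable lborel (\<lambda>X. dot_grad v p X)"
  unfolding dot_grad_def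
  by (intro Bochner_Integration.integrable_sum integrable_scaleR_right
      schwartz_integrable[OF schwartz_partial[OF assms]])

text \<open>Both sides are the derivative at \<open>t = 0\<close> of the transform of \<open>p (X - t v)\<close>, which avoids
  integration by parts.\<close>

lemma fourier_dot_grad:
  fixes p :: "'a::euclidean_space \<Rightarrow> complex"
  assumes p: "schwartz p"
  shows "(LINT X|lborel. exp (\<i> * of_real (k \<bullet> X)) * dot_grad v p X) = - \<i> * of_real (k \<bullet> v) * fourier p k"
proof -
  note pm[measurable] = schwartz_measurable[OF p]
  obtain C1 where C1: "0 \<le> C1" "\<And>v X. norm (dot_grad v p X) \<le> C1 * norm v * decay X"
    using schwartz_dot_grad_decay[OF p] by blast
  obtain C2 where C2: "0 \<le> C2" "\<And>X Y. norm Y \<le> 1 \<Longrightarrow> norm (p (X - Y) - p X) \<le> C2 * norm Y * decay X"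
    using schwartz_diff_decay[OF p] by blast
  let ?e = "\<lambda>X. exp (\<i> * complex_of_real (k \<bullet> X))"
  \<comment> \<open>Small enough that the shift \<open>t v\<close> has norm at most 1, the range of
    \<open>schwartz_diff_decay\<close>.\<close>
  let ?\<delta> = "inverse (1 + norm v)"
  have \<delta>: "0 < ?\<delta>" by (simp add: add_pos_nonneg)
  have "((\<lambda>t. LINT X|lborel. ?e X * p (X - t *\<^sub>R v)) has_vector_derivative
      (LINT X|lborel. ?e X * (- dot_grad v p X))) (at 0)"
  proof (rule has_vector_derivative_integral[where \<delta>="?\<delta>" and g="\<lambda>X. (C1 + C2) * norm v * decay X"])
    show "0 < ?\<delta>" by fact
    show "integrable lborel (\<lambda>X. ?e X * p (X - t *\<^sub>R v))" for t
      by (intro integrable_exp_mult integrable_lborel_shift schwartz_integrable p)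
    show "integrable lborel (\<lambda>X::'a. (C1 + C2) * norm v * decay X)"
      by (intro integrable_mult_right integrable_decay)
    show "(\<lambda>X. ?e X * (- dot_grad v p X)) \<in> borel_measurable lborel"
      using schwartz_dot_grad_measurable[OF p, of v] by measurable
    fix X :: 'a
    have "((\<lambda>t. X - t *\<^sub>R v) has_derivative (\<lambda>h. - (h *\<^sub>R v))) (at 0)"
      by (auto intro!: derivative_eq_intros)
    from has_derivative_compose[OF this schwartz_has_derivative[OF p]]
    have "((\<lambda>t. p (X - t *\<^sub>R v)) has_derivative (\<lambda>h. dot_grad (- (h *\<^sub>R v)) p X)) (at 0)" by simp
    also have "(\<lambda>h. dot_grad (- (h *\<^sub>R v)) p X) = (\<lambda>h. h *\<^sub>R (- dot_grad v p X))"
      by (auto simp: dot_grad_def scaleR_sum_right sum_negf)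
    finally show "((\<lambda>t. ?e X * p (X - t *\<^sub>R v)) has_vector_derivative ?e X * (- dot_grad v p X)) (at 0)"
      by (intro has_vector_derivative_mult_right) (simp add: has_vector_derivative_def)
    show "norm (?e X * (- dot_grad v p X)) \<le> (C1 + C2) * norm v * decay X"
    proof -
      have "C1 * norm v * decay X \<le> (C1 + C2) * norm v * decay X"
        using C2(1) decay_nonneg by (intro mult_right_mono) auto
      then show ?thesis using C1(2)[of v X] by (simp only: norm_mult norm_exp_i_times norm_minus_cancel mult_1)
    qed
    fix t :: real assume "\<bar>t - 0\<bar> < ?\<delta>"
    then have "\<bar>t\<bar> * (1 + norm v) < 1" using \<delta> by (simp add: field_simps add_pos_nonneg)
    then have "norm (t *\<^sub>R v) \<le> 1" using abs_ge_zero[of t] by (simp only: norm_scaleR distrib_left)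
    then have "norm (p (X - t *\<^sub>R v) - p X) \<le> C2 * (\<bar>t\<bar> * norm v) * decay X"
      using C2(2)[of "t *\<^sub>R v" X] by simp
    also have "\<dots> \<le> (C1 + C2) * (\<bar>t\<bar> * norm v) * decay X"
      using C1(1) decay_nonneg by (intro mult_right_mono) auto
    finally show "norm (?e X * p (X - t *\<^sub>R v) - ?e X * p (X - 0 *\<^sub>R v)) \<le> \<bar>t - 0\<bar> * ((C1 + C2) * norm v * decay X)"
      by (simp only: right_diff_distrib[symmetric] norm_mult norm_exp_i_times scaleR_zero_left diff_zero) (simp add: mult_ac)
  qed
  \<comment> \<open>The same derivative computed from \<open>fourier_shift\<close>, where
    \<open>t\<close> enters only through a phase.\<close>
  moreover have "((\<lambda>t. LINT X|lborel. ?e X * p (X - t *\<^sub>R v)) has_vector_derivative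
      \<i> * of_real (k \<bullet> v) * exp (\<i> * complex_of_real (0 * (k \<bullet> v))) * fourier p k) (at 0)"
    unfolding fourier_shift[OF pm] inner_scaleR_right
    by (intro has_vector_derivative_mult_left exp_i_vector_derivative)
  ultimately have "(LINT X|lborel. ?e X * (- dot_grad v p X)) =
      \<i> * of_real (k \<bullet> v) * exp (\<i> * complex_of_real (0 * (k \<bullet> v))) * fourier p k"
    by (rule vector_derivative_unique_at)
  then have "- (LINT X|lborel. ?e X * dot_grad v p X) = \<i> * of_real (k \<bullet> v) * fourier p k"
    by simp
  then show ?thesis by (simp add: minus_equation_iff)
qed

lemma incr_fourier:
  fixes p :: "'a::euclidean_space \<Rightarrow> complex"
  assumes p: "schwartz p"
  shows "(LINT X|lborel. exp (\<i> * of_real (k \<bullet> X)) * incr b p X Y) = osc b (k \<bullet> Y) * fourier p k"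
proof -
  note pm[measurable] = schwartz_measurable[OF p]
  let ?e = "\<lambda>X. exp (\<i> * complex_of_real (k \<bullet> X))"
  have i: "integrable lborel (\<lambda>X. ?e X * p (X - Y))" "integrable lborel (\<lambda>X. ?e X * p X)"
    "integrable lborel (\<lambda>X. ?e X * dot_grad Y p X)"
    by (intro integrable_exp_mult integrable_lborel_shift schwartz_integrable p schwartz_dot_grad_integrable)+
  have "(LINT X|lborel. ?e X * incr b p X Y) =
      (LINT X|lborel. (?e X * p (X - Y) - ?e X * p X) + of_bool b * (?e X * dot_grad Y p X))"
    by (simp add: incr_def algebra_simps)
  also have "\<dots> = (LINT X|lborel. ?e X * p (X - Y)) - (LINT X|lborel. ?e X * p X)
      + of_bool b * (LINT X|lborel. ?e X * dot_grad Y p X)"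
    using i by (subst Bochner_Integration.integral_add) auto
  also have "\<dots> = osc b (k \<bullet> Y) * fourier p k"
    unfolding fourier_shift[OF pm] fourier_dot_grad[OF p] fourier_eq_lborel[OF pm, symmetric]
    by (simp add: osc_def algebra_simps)
  finally show ?thesis .
qed

lemma incr_measurable:
  fixes p :: "'a::euclidean_space \<Rightarrow> complex"
  assumes p: "schwartz p"
  shows "(\<lambda>(Y, X). incr b p X Y) \<in> borel_measurable (lborel \<Otimes>\<^sub>M lborel)"
proof -
  note [measurable] = schwartz_measurable[OF p]
  have "(\<lambda>(Y, X). dot_grad Y p X) \<in> borel_measurable (lborel \<Otimes>\<^sub>M lborel)"
    unfolding dot_grad_def case_prod_beta'
    by (intro borel_measurable_sum borel_measurable_scaleR borel_measurable_inner borel_measurable_const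
        measurable_compose[OF _ schwartz_measurable[OF schwartz_partial[OF p]]]) measurable
  then have [measurable]: "(\<lambda>z. dot_grad (fst z) p (snd z)) \<in> borel_measurable (lborel \<Otimes>\<^sub>M lborel)"
    by (simp add: case_prod_beta')
  show ?thesis
    unfolding incr_def case_prod_beta' by measurable
qed

text \<open>Fubini: by \<open>incr_bound\<close> the norm integrated over \<open>X\<close> is at
  most a constant times \<open>weight b (norm Y) * \<kappa> Y\<close>, because both decay terms have
  the same integral. After the exchange \<open>incr_fourier\<close> evaluates the inner
  integral.\<close>

lemma
  fixes p :: "'a::euclidean_space \<Rightarrow> complex" and \<kappa> :: "'a \<Rightarrow> real"
  assumes p: "schwartz p"
    and [measurable]: "\<kappa> \<in> borel_measurable borel"
    and nonneg: "\<And>Y. 0 \<le> \<kappa> Y"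
    and int: "integrable lborel (\<lambda>Y. weight b (norm Y) * \<kappa> Y)"
  shows integrable_integral_incr: "integrable lborel (\<lambda>X. LINT Y|lborel. incr b p X Y * of_real (\<kappa> Y))"
    and fourier_integral_incr: "fourier (\<lambda>X. LINT Y|lborel. incr b p X Y * of_real (\<kappa> Y)) k =
      (LINT Y|lborel. osc b (k \<bullet> Y) * of_real (\<kappa> Y)) * fourier p k"
proof -
  obtain C where C: "0 \<le> C" "\<And>X Y. norm (incr b p X Y) \<le> C * weight b (norm Y) * (decay X + decay (X - Y))"
    using incr_bound[OF p] by blast
  note [measurable] = incr_measurable[OF p, of b]
  have mX[measurable]: "(\<lambda>X. incr b p X Y) \<in> borel_measurable borel" for Y
    using measurable_compose[OF measurable_Pair1' incr_measurable[OF p, of b], of Y] by simp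
  have mY[measurable]: "(\<lambda>Y. incr b p X Y) \<in> borel_measurable borel" for X
    using measurable_compose[OF measurable_Pair2' incr_measurable[OF p, of b], of X] by simp
  have int_bound: "integrable lborel (\<lambda>X. C * weight b (norm Y) * (decay X + decay (X - Y)))" for Y :: 'a
    by (intro integrable_mult_right Bochner_Integration.integrable_add integrable_decay integrable_lborel_shift)
  have int_X: "integrable lborel (\<lambda>X. incr b p X Y)" for Y
    by (rule Bochner_Integration.integrable_bound[OF int_bound[of Y]])
      (use C(2) in \<open>auto intro: order_trans[OF _ abs_ge_self]\<close>)
  let ?e = "\<lambda>k X. exp (\<i> * complex_of_real (k \<bullet> X))"
  let ?f = "\<lambda>k Y X. ?e k X * (incr b p X Y * of_real (\<kappa> Y))"
  have m: "(\<lambda>(Y, X). ?f k Y X) \<in> borel_measurable (lborel \<Otimes>\<^sub>M lborel)" for k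
    using incr_measurable[OF p, of b] unfolding case_prod_beta' by measurable
  have norm_eq: "(LINT X|lborel. norm (?f k Y X)) = (LINT X|lborel. norm (incr b p X Y)) * \<kappa> Y" for k Y
    using nonneg[of Y] by (simp add: norm_mult)
  have Fub: "integrable (lborel \<Otimes>\<^sub>M lborel) (\<lambda>(Y, X). ?f k Y X)" for k
  proof (rule lborel_pair.Fubini_integrable[OF m])
    define D where "D = (LINT X|lborel. decay (X::'a))"
    show "integrable lborel (\<lambda>Y. LINT X|lborel. norm (case (Y, X) of (Y, X) \<Rightarrow> ?f k Y X))"
    proof (rule Bochner_Integration.integrable_bound)
      show "integrable lborel (\<lambda>Y. C * (2 * D) * (weight b (norm Y) * \<kappa> Y))" using int by simp
      show "(\<lambda>Y. LINT X|lborel. norm (case (Y, X) of (Y, X) \<Rightarrow> ?f k Y X)) \<in> borel_measurable lborel"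
        using m[of k] by (intro lborel.borel_measurable_lebesgue_integral) (simp add: case_prod_beta')
      show "AE Y in lborel. norm (LINT X|lborel. norm (case (Y, X) of (Y, X) \<Rightarrow> ?f k Y X))
          \<le> norm (C * (2 * D) * (weight b (norm Y) * \<kappa> Y))"
      proof (rule AE_I2)
        fix Y :: 'a
        have "(LINT X|lborel. norm (incr b p X Y)) \<le> (LINT X|lborel. C * weight b (norm Y) * (decay X + decay (X - Y)))"
          using C(2) by (intro integral_mono integrable_norm int_X int_bound)
        also have "\<dots> = C * weight b (norm Y) * (2 * D)"
          using integrable_decay[where 'a='a] integral_lborel_shift[of "decay :: 'a \<Rightarrow> real" Y] integrable_lborel_shift[OF integrable_decay, of Y]
          by (simp add: D_def Bochner_Integration.integral_add)
        finally have "(LINT X|lborel. norm (incr b p X Y)) * \<kappa> Y \<le> C * weight b (norm Y) * (2 * D) * \<kappa> Y"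
          using nonneg by (intro mult_right_mono)
        moreover have "0 \<le> (LINT X|lborel. norm (incr b p X Y)) * \<kappa> Y"
          using nonneg by (intro mult_nonneg_nonneg integral_nonneg) auto
        ultimately show "norm (LINT X|lborel. norm (case (Y, X) of (Y, X) \<Rightarrow> ?f k Y X))
          \<le> norm (C * (2 * D) * (weight b (norm Y) * \<kappa> Y))"
          unfolding prod.case norm_eq by (simp only: real_norm_def abs_of_nonneg mult_ac)
      qed
    qed
    show "AE Y in lborel. integrable lborel (\<lambda>X. case (Y, X) of (Y, X) \<Rightarrow> ?f k Y X)"
      unfolding prod.case by (intro AE_I2 integrable_exp_mult integrable_mult_left int_X)
  qed
  have eq: "(LINT Y|lborel. ?f k Y X) = ?e k X * (LINT Y|lborel. incr b p X Y * of_real (\<kappa> Y))" for k X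
    by simp
  \<comment> \<open>At frequency 0 the exponential is 1, so this is an instance of the same Fubini
    statement.\<close>
  have "integrable lborel (\<lambda>X. LINT Y|lborel. ?f 0 Y X)"
    by (rule lborel_pair.integrable_snd[OF Fub])
  then show int_L: "integrable lborel (\<lambda>X. LINT Y|lborel. incr b p X Y * of_real (\<kappa> Y))"
    by simp
  have "fourier (\<lambda>X. LINT Y|lborel. incr b p X Y * of_real (\<kappa> Y)) k = (LINT X|lborel. LINT Y|lborel. ?f k Y X)"
    unfolding eq by (rule fourier_eq_lborel) (use int_L in simp)
  also have "\<dots> = (LINT Y|lborel. LINT X|lborel. ?f k Y X)"
    by (rule lborel_pair.Fubini_integral[OF Fub])
  also have "\<dots> = (LINT Y|lborel. (osc b (k \<bullet> Y) * of_real (\<kappa> Y)) * fourier p k)"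
  proof (intro Bochner_Integration.integral_cong refl)
    fix Y
    have "(LINT X|lborel. ?f k Y X) = (LINT X|lborel. (?e k X * incr b p X Y) * of_real (\<kappa> Y))"
      by (simp only: mult.assoc)
    also have "\<dots> = (LINT X|lborel. ?e k X * incr b p X Y) * of_real (\<kappa> Y)"
      by simp
    finally show "(LINT X|lborel. ?f k Y X) = (osc b (k \<bullet> Y) * of_real (\<kappa> Y)) * fourier p k"
      unfolding incr_fourier[OF p] by (simp only: mult_ac)
  qed
  finally show "fourier (\<lambda>X. LINT Y|lborel. incr b p X Y * of_real (\<kappa> Y)) k =
      (LINT Y|lborel. osc b (k \<bullet> Y) * of_real (\<kappa> Y)) * fourier p k"
    by simp
qed

section \<open>The symbol of the operator\<close>

text \<open>Serves to replace the density \<open>m\<close> by a Borel version under the integral: in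
  a complete measure space, equality almost everywhere to a measurable function implies
  measurability.\<close>

lemma
  fixes f g :: "'a \<Rightarrow> 'b::{banach, second_countable_topology}"
  assumes eq: "AE x in M. f x = g x" and g[measurable]: "g \<in> borel_measurable M"
  shows borel_measurable_completion_AE: "f \<in> borel_measurable (completion M)"
    and integrable_completion_AE: "integrable (completion M) f \<longleftrightarrow> integrable M g"
    and integral_completion_AE: "(LINT x|completion M. f x) = (LINT x|M. g x)"
proof -
  have eq': "AE x in completion M. f x = g x" by (rule AE_completion[OF eq])
  have g': "g \<in> borel_measurable (completion M)" by (rule measurable_completion[OF g])
  show f: "f \<in> borel_measurable (completion M)"
  proof (rule measurableI)
    fix A :: "'b set" assume "A \<in> sets borel"
    then have A: "g -` A \<inter> space (completion M) \<in> sets (completion M)" by (rule measurable_sets[OF g'])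
    have ae: "AE x in completion M. x \<in> g -` A \<inter> space (completion M) \<longleftrightarrow> x \<in> f -` A \<inter> space (completion M)"
      using eq' by eventually_elim simp
    show "f -` A \<inter> space (completion M) \<in> sets (completion M)"
      by (rule completion.in_sets_AE[OF ae A]) simp
  qed simp
  show "integrable (completion M) f \<longleftrightarrow> integrable M g"
    using integrable_cong_AE[OF f g' eq'] by (simp add: integrable_completion)
  show "(LINT x|completion M. f x) = (LINT x|M. g x)"
    using integral_cong_AE[OF f g' eq'] by (simp add: integral_completion)
qed

text \<open>Reflection preserves Lebesgue measure. The completed measure is kept because the kernel
  built from \<open>m\<close> may fail to be Borel.\<close>

lemma integral_lebesgue_odd:
  fixes f :: "'a::euclidean_space \<Rightarrow> 'b::{banach, second_countable_topology}"
  assumes f: "f \<in> borel_measurable lebesgue" and odd: "\<And>x. f (- x) = - f x"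
  shows "(LINT x|lebesgue. f x) = 0"
proof -
  \<comment> \<open>Reflection in coordinates, to match the shape of
    \<open>lebesgue_affine_euclidean\<close>.\<close>
  define T :: "'a \<Rightarrow> 'a" where "T x = 0 + (\<Sum>j\<in>Basis. (- 1 * (x \<bullet> j)) *\<^sub>R j)" for x
  have T: "T = uminus"
    by (rule ext) (simp add: T_def sum_negf euclidean_representation)
  have *: "lebesgue = density (distr lebesgue lebesgue T) (\<lambda>_. (\<Prod>j\<in>(Basis::'a set). \<bar>- 1 :: real\<bar>))"
    unfolding T_def by (rule lebesgue_affine_euclidean) simp
  have **: "T \<in> lebesgue \<rightarrow>\<^sub>M lebesgue"
    unfolding T_def by (rule lebesgue_affine_measurable) simp
  have "(LINT x|lebesgue. f x) = (LINT x|distr lebesgue lebesgue T. f x)"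
    by (subst *) (simp add: density_1 one_ennreal_def[symmetric])
  also have "\<dots> = (LINT x|lebesgue. f (- x))"
    using f ** unfolding T by (subst integral_distr) auto
  also have "\<dots> = - (LINT x|lebesgue. f x)"
    by (simp add: odd)
  finally show ?thesis
    by (simp add: eq_neg_iff_add_eq_0 flip: scaleR_2)
qed

text \<open>The cone over a null set of the sphere is a null set, by \<open>polar_emeasure\<close>
  with \<open>B = UNIV\<close> and \<open>0 * \<infinity> = 0\<close>.\<close>

lemma AE_sphere_imp_AE_lborel:
  assumes "AE \<phi> in (sphere_measure :: 'a::euclidean_space measure). P \<phi>"
  shows "AE Y in lborel. Y \<noteq> 0 \<longrightarrow> P (Y /\<^sub>R norm Y)"
proof -
  obtain N where N: "{\<phi> \<in> space sphere_measure. \<not> P \<phi>} \<subseteq> N" "emeasure sphere_measure N = 0"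
    "N \<in> sets (sphere_measure :: 'a measure)"
    by (rule AE_E[OF assms]) auto
  have Nb[measurable]: "N \<in> sets borel" using N(3) by (simp add: sets_sphere_measure_iff)
  let ?C = "{Y. Y \<noteq> 0 \<and> Y /\<^sub>R norm Y \<in> N}"
  have "emeasure lborel ?C = 0"
    using polar_emeasure[OF N(3), of UNIV] N(2) by simp
  moreover have "?C \<in> sets borel" by measurable
  ultimately have "?C \<in> null_sets lborel" by (auto simp: null_sets_def)
  then show ?thesis
    by (rule AE_I') (use N(1) in auto)
qed

text \<open>A function measurable for the completion has a measurable version. Its absolute value,
  set to 0 off the sphere, is nonnegative and Borel everywhere and still agrees with
  \<open>m\<close>, which is nonnegative on the sphere.\<close>

lemma sphere_density_borel:
  assumes "sphere_density m"
  obtains m' :: "'a::euclidean_space \<Rightarrow> real" where "m' \<in> borel_measurable borel" "\<And>x. 0 \<le> m' x"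
    "AE \<phi> in sphere_measure. m \<phi> = m' \<phi>"
proof -
  have nonneg: "\<And>\<phi>. \<phi> \<in> sphere 0 1 \<Longrightarrow> 0 \<le> m \<phi>" and "m \<in> borel_measurable (completion sphere_measure)"
    using assms by (auto simp: sphere_density_def surface_measure_eq dest: borel_measurable_has_bochner_integral)
  then obtain g where g: "g \<in> borel_measurable sphere_measure" "AE \<phi> in sphere_measure. m \<phi> = g \<phi>"
    using completion_ex_borel_measurable_real by blast
  show thesis
  proof
    have "(\<lambda>x. \<bar>g x\<bar>) \<in> borel_measurable (restrict_space borel (sphere 0 1))"
      using g(1) unfolding measurable_cong_sets[OF sets_sphere_measure refl] by measurable
    then show "(\<lambda>x. indicator (sphere 0 1) x *\<^sub>R \<bar>g x\<bar>) \<in> borel_measurable borel"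
      by (subst (asm) borel_measurable_restrict_space_iff) auto
    show "AE \<phi> in sphere_measure. m \<phi> = indicator (sphere 0 1) \<phi> *\<^sub>R \<bar>g \<phi>\<bar>"
      using g(2) AE_space
    proof eventually_elim
      case (elim \<phi>)
      then show ?case using nonneg[of \<phi>] by simp
    qed
  qed simp
qed

text \<open>Due to \<open>0 powr a = 0\<close> and \<open>x / 0 = 0\<close>; hence the origin need not be excluded explicitly.\<close>

lemma tempered_kernel_0 [simp]: "tempered_kernel \<beta> lam m 0 = 0"
  by (simp add: tempered_kernel_def)

lemma norm_osc_inner_le: "norm (osc b (k \<bullet> Y)) \<le> 2 * (1 + norm k)\<^sup>2 * weight b (norm Y)"
proof -
  have "norm (osc b (k \<bullet> Y)) \<le> 2 * weight b \<bar>k \<bullet> Y\<bar>" by (rule norm_osc_le)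
  also have "\<dots> \<le> 2 * weight b (norm k * norm Y)"
    by (intro mult_left_mono weight_mono Cauchy_Schwarz_ineq2) auto
  also have "\<dots> \<le> 2 * ((1 + norm k)\<^sup>2 * weight b (norm Y))"
    by (intro mult_left_mono weight_mult_le) auto
  finally show ?thesis by simp
qed

lemma Gamma_one_minus:
  assumes "admissible \<beta> b"
  shows "Gamma (1 - \<beta>) = - \<beta> * Gamma (- \<beta>)"
  using Gamma_plus1[of "- \<beta>"] admissible_not_nonpos_Ints[OF assms] by simp

text \<open>The functional equation leads from \<open>- \<beta>\<close> to a positive argument in
  one step for \<beta> < 1 and in two for \<beta> > 1, and each step changes the sign.\<close>

lemma Gamma_sign:
  assumes "admissible \<beta> b"
  shows "Gamma (- \<beta>) / \<bar>Gamma (- \<beta>)\<bar> = (- 1) ^ nat \<lceil>\<beta>\<rceil>"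
proof (cases b)
  case False
  with assms have \<beta>: "0 < \<beta>" "\<beta> < 1" by (auto simp: admissible_def)
  then have "0 < Gamma (1 - \<beta>)" by (intro Gamma_real_pos) simp
  then have "Gamma (- \<beta>) < 0"
    using \<beta> by (simp add: Gamma_one_minus[OF assms] mult_less_0_iff)
  moreover have "\<lceil>\<beta>\<rceil> = 1" using \<beta> by (simp add: ceiling_eq_iff)
  ultimately show ?thesis by simp
next
  case True
  with assms have \<beta>: "1 < \<beta>" "\<beta> < 2" by (auto simp: admissible_def)
  then have "0 < Gamma (2 - \<beta>)" by (intro Gamma_real_pos) simp
  moreover have "admissible (\<beta> - 1) False" using \<beta> by (auto simp: admissible_def)
  from Gamma_one_minus[OF this] have "Gamma (2 - \<beta>) = - (\<beta> - 1) * Gamma (1 - \<beta>)" by simp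
  ultimately have "0 < Gamma (- \<beta>)"
    using \<beta> by (simp add: Gamma_one_minus[OF assms] zero_less_mult_iff mult_less_0_iff)
  moreover have "\<lceil>\<beta>\<rceil> = 2" using \<beta> by (simp add: ceiling_eq_iff)
  ultimately show ?thesis by simp
qed

text \<open>The density \<open>m\<close> is only Lebesgue measurable; \<open>m'\<close> is a Borel version, to which Fubini applies.\<close>

locale tempered_density =
  fixes m m' :: "'a::euclidean_space \<Rightarrow> real" and lam \<beta> :: real and b :: bool
  assumes density: "sphere_density m" and lam: "0 \<le> lam" and adm: "admissible \<beta> b"
    and m'_borel [measurable]: "m' \<in> borel_measurable borel" and m'_nonneg: "\<And>x. 0 \<le> m' x"
    and m'_AE: "AE \<phi> in sphere_measure. m \<phi> = m' \<phi>"
begin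

abbreviation "K \<equiv> tempered_kernel \<beta> lam m"
abbreviation "K' \<equiv> tempered_kernel \<beta> lam m'"

lemma K'_borel [measurable]: "K' \<in> borel_measurable borel"
  unfolding tempered_kernel_def[abs_def] by measurable

lemma K'_nonneg: "0 \<le> K' Y"
  unfolding tempered_kernel_def using m'_nonneg by simp

lemma K_AE: "AE Y in lborel. K Y = K' Y"
  using AE_sphere_imp_AE_lborel[OF m'_AE]
proof eventually_elim
  case (elim Y)
  then show ?case by (cases "Y = 0") (simp_all add: tempered_kernel_def)
qed

text \<open>The Jacobian cancels the dimension in the exponent of the kernel, so the radial
  integrals are the same in every dimension.\<close>

lemma K'_polar:
  assumes "\<phi> \<in> sphere 0 1" "0 < r"
  shows "r ^ (DIM('a) - 1) * K' (r *\<^sub>R \<phi>) = m' \<phi> * (exp (- (lam * r)) * r powr (- 1 - \<beta>))"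
proof -
  have "r ^ (DIM('a) - 1) = r powr (real DIM('a) - 1)"
    using DIM_positive[where 'a='a] assms(2) by (simp add: of_nat_diff Suc_leI flip: powr_realpow)
  moreover have "r powr (real DIM('a) - 1) / r powr (real DIM('a) + \<beta>) = r powr (- 1 - \<beta>)"
    by (simp flip: powr_diff)
  ultimately show ?thesis
    using assms by (simp add: tempered_kernel_def exp_minus field_simps)
qed

lemma borel_measurable_sphere_m' [measurable]: "m' \<in> borel_measurable sphere_measure"
  by (rule borel_measurable_sphere_measure) measurable

lemma integrable_m': "integrable sphere_measure m'"
proof -
  have "integrable (completion sphere_measure) m"
    using density by (auto simp: sphere_density_def surface_measure_eq has_bochner_integral_iff)
  then show ?thesis using integrable_completion_AE[OF m'_AE] by simp
qed

text \<open>Polar coordinates factor the bound into the mass of \<open>m'\<close> and the radial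
  integral of \<open>integrable_weight\<close>; the exponential is bounded by 1, which covers
  \<open>lam = 0\<close>.\<close>

lemma integrable_weight_K': "integrable lborel (\<lambda>Y. weight b (norm Y) * K' Y)"
proof (rule integrableI_bounded)
  let ?c = "\<integral>\<^sup>+ r. ennreal (weight b r * r powr (- 1 - \<beta>)) \<partial>halfline"
  have c: "?c < \<infinity>"
    using integrable_weight[OF adm] unfolding integrable_iff_bounded
    by (auto elim!: le_less_trans[rotated] intro!: nn_integral_mono ennreal_leI)
  have "(\<integral>\<^sup>+ Y. ennreal (norm (weight b (norm Y) * K' Y)) \<partial>lborel) =
      (\<integral>\<^sup>+ \<phi>. (\<integral>\<^sup>+ r. ennreal (r ^ (DIM('a) - 1)) * ennreal (norm (weight b (norm (r *\<^sub>R \<phi>)) * K' (r *\<^sub>R \<phi>))) \<partial>halfline) \<partial>sphere_measure)"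
    by (rule nn_integral_polar) measurable
  also have "\<dots> \<le> (\<integral>\<^sup>+ \<phi>. ennreal (m' \<phi>) * ?c \<partial>sphere_measure)"
  proof (rule nn_integral_mono)
    fix \<phi> :: 'a assume "\<phi> \<in> space sphere_measure"
    then have \<phi>: "\<phi> \<in> sphere 0 1" by simp
    have "(\<integral>\<^sup>+ r. ennreal (r ^ (DIM('a) - 1)) * ennreal (norm (weight b (norm (r *\<^sub>R \<phi>)) * K' (r *\<^sub>R \<phi>))) \<partial>halfline)
        \<le> (\<integral>\<^sup>+ r. ennreal (m' \<phi>) * ennreal (weight b r * r powr (- 1 - \<beta>)) \<partial>halfline)"
    proof (rule nn_integral_mono)
      fix r assume "r \<in> space halfline"
      then have r: "0 < r" by simp
      have "r ^ (DIM('a) - 1) * norm (weight b (norm (r *\<^sub>R \<phi>)) * K' (r *\<^sub>R \<phi>)) =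
          weight b r * (r ^ (DIM('a) - 1) * K' (r *\<^sub>R \<phi>))"
        using r \<phi> K'_nonneg by (simp add: abs_mult weight_nonneg)
      also have "\<dots> = (m' \<phi> * (weight b r * r powr (- 1 - \<beta>))) * exp (- (lam * r))"
        unfolding K'_polar[OF \<phi> r] by (simp only: mult_ac)
      also have "\<dots> \<le> (m' \<phi> * (weight b r * r powr (- 1 - \<beta>))) * 1"
        using lam r m'_nonneg by (intro mult_left_mono) (auto simp: weight_nonneg)
      finally show "ennreal (r ^ (DIM('a) - 1)) * ennreal (norm (weight b (norm (r *\<^sub>R \<phi>)) * K' (r *\<^sub>R \<phi>)))
          \<le> ennreal (m' \<phi>) * ennreal (weight b r * r powr (- 1 - \<beta>))"
        using r m'_nonneg by (subst (1 2) ennreal_mult[symmetric]) (auto simp: weight_nonneg intro!: ennreal_leI)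
    qed
    also have "\<dots> = ennreal (m' \<phi>) * ?c"
      by (rule nn_integral_cmult) (auto intro!: borel_measurable_halfline)
    finally show "(\<integral>\<^sup>+ r. ennreal (r ^ (DIM('a) - 1)) * ennreal (norm (weight b (norm (r *\<^sub>R \<phi>)) * K' (r *\<^sub>R \<phi>))) \<partial>halfline)
        \<le> ennreal (m' \<phi>) * ?c" .
  qed
  also have "\<dots> = (\<integral>\<^sup>+ \<phi>. ennreal (m' \<phi>) \<partial>sphere_measure) * ?c"
    by (rule nn_integral_multc) measurable
  also have "\<dots> < \<infinity>"
  proof -
    have "(\<integral>\<^sup>+ \<phi>. ennreal (m' \<phi>) \<partial>sphere_measure) < \<infinity>"
      using integrable_m' m'_nonneg unfolding integrable_iff_bounded by simp
    with c show ?thesis by (simp add: ennreal_mult_less_top)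
  qed
  finally show "(\<integral>\<^sup>+ Y. ennreal (norm (weight b (norm Y) * K' Y)) \<partial>lborel) < \<infinity>" .
qed measurable

definition symbol :: "'a \<Rightarrow> complex" where
  "symbol k = (LINT \<phi>|surface_measure. ((of_real lam - \<i> * of_real (k \<bullet> \<phi>)) powr of_real \<beta>
     - of_real (lam powr \<beta>)) * of_real (m \<phi>))"

lemma integrable_m'_scaleR: "integrable sphere_measure (\<lambda>\<phi>. m' \<phi> *\<^sub>R \<phi>)"
proof (rule Bochner_Integration.integrable_bound[OF integrable_m'])
  have [measurable]: "(\<lambda>\<phi>. \<phi>) \<in> borel_measurable (sphere_measure :: 'a measure)"
    by (rule borel_measurable_sphere_measure) simp
  show "(\<lambda>\<phi>. m' \<phi> *\<^sub>R \<phi>) \<in> borel_measurable sphere_measure" by measurable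
qed (auto intro!: AE_I2)

lemma drift_eq: "drift m = (LINT \<phi>|sphere_measure. m' \<phi> *\<^sub>R \<phi>)"
  unfolding drift_def surface_measure_eq
proof (rule integral_completion_AE)
  show "AE \<phi> in sphere_measure. m \<phi> *\<^sub>R \<phi> = m' \<phi> *\<^sub>R \<phi>"
    using m'_AE by eventually_elim simp
qed (use integrable_m'_scaleR in auto)

lemma inner_drift: "(LINT \<phi>|sphere_measure. m' \<phi> * (k \<bullet> \<phi>)) = k \<bullet> drift m"
  unfolding drift_eq integral_inner_right[OF integrable_m'_scaleR, symmetric] by simp

lemma integrable_osc_K': "integrable lborel (\<lambda>Y. osc b (k \<bullet> Y) * of_real (K' Y))"
proof (rule Bochner_Integration.integrable_bound)
  show "integrable lborel (\<lambda>Y. 2 * (1 + norm k)\<^sup>2 * (weight b (norm Y) * K' Y))"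
    using integrable_weight_K' by simp
  show "AE Y in lborel. norm (osc b (k \<bullet> Y) * of_real (K' Y)) \<le> norm (2 * (1 + norm k)\<^sup>2 * (weight b (norm Y) * K' Y))"
  proof (rule AE_I2)
    fix Y
    show "norm (osc b (k \<bullet> Y) * of_real (K' Y)) \<le> norm (2 * (1 + norm k)\<^sup>2 * (weight b (norm Y) * K' Y))"
      using mult_right_mono[OF norm_osc_inner_le[of b k Y] K'_nonneg[of Y]] K'_nonneg[of Y]
      by (simp add: norm_mult abs_mult weight_nonneg mult_ac)
  qed
qed measurable

text \<open>\<open>osc_radial_integral\<close> with frequency \<open>k \<bullet> \<phi>\<close>
  evaluates each ray; its linear term, averaged against \<open>m'\<close>, produces the drift
  vector.\<close>

lemma integral_osc_K':
  "(LINT Y|lborel. osc b (k \<bullet> Y) * of_real (K' Y)) = of_real (Gamma (- \<beta>)) *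
     (symbol k + of_bool b * (\<i> * of_real (\<beta> * lam powr (\<beta> - 1) * (k \<bullet> drift m))))"
proof -
  let ?s = "\<lambda>\<phi>. (of_real lam - \<i> * of_real (k \<bullet> \<phi>)) powr of_real \<beta> - complex_of_real (lam powr \<beta>)"
  let ?d = "\<lambda>\<phi>. of_bool b * (\<i> * complex_of_real ((k \<bullet> \<phi>) * \<beta> * lam powr (\<beta> - 1)))"
  have G0: "complex_of_real (Gamma (- \<beta>)) \<noteq> 0"
    using admissible_not_nonpos_Ints[OF adm] by (simp add: Gamma_eq_zero_iff)
  have rad: "(LINT r|halfline. r ^ (DIM('a) - 1) *\<^sub>R (osc b (k \<bullet> (r *\<^sub>R \<phi>)) * of_real (K' (r *\<^sub>R \<phi>))))
     = of_real (Gamma (- \<beta>)) * (of_real (m' \<phi>) * (?s \<phi> + ?d \<phi>))" if \<phi>: "\<phi> \<in> space sphere_measure" for \<phi>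
  proof -
    have "(LINT r|halfline. r ^ (DIM('a) - 1) *\<^sub>R (osc b (k \<bullet> (r *\<^sub>R \<phi>)) * of_real (K' (r *\<^sub>R \<phi>))))
      = (LINT r|halfline. of_real (m' \<phi>) * (osc b ((k \<bullet> \<phi>) * r) * of_real (exp (- (lam * r)) * r powr (- 1 - \<beta>))))"
    proof (rule Bochner_Integration.integral_cong)
      fix r assume r: "r \<in> space halfline"
      have "r ^ (DIM('a) - 1) *\<^sub>R (osc b (k \<bullet> (r *\<^sub>R \<phi>)) * of_real (K' (r *\<^sub>R \<phi>))) =
          osc b ((k \<bullet> \<phi>) * r) * of_real (r ^ (DIM('a) - 1) * K' (r *\<^sub>R \<phi>))"
        by (simp add: scaleR_conv_of_real mult_ac)
      also have "r ^ (DIM('a) - 1) * K' (r *\<^sub>R \<phi>) = m' \<phi> * (exp (- (lam * r)) * r powr (- 1 - \<beta>))"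
        using r \<phi> by (intro K'_polar) auto
      finally show "r ^ (DIM('a) - 1) *\<^sub>R (osc b (k \<bullet> (r *\<^sub>R \<phi>)) * of_real (K' (r *\<^sub>R \<phi>))) =
          of_real (m' \<phi>) * (osc b ((k \<bullet> \<phi>) * r) * of_real (exp (- (lam * r)) * r powr (- 1 - \<beta>)))"
        by (simp only: of_real_mult mult_ac)
    qed simp
    also have "\<dots> = of_real (m' \<phi>) * (LINT r|halfline. osc b ((k \<bullet> \<phi>) * r) * of_real (exp (- (lam * r)) * r powr (- 1 - \<beta>)))"
      by (rule integral_mult_right_zero)
    finally show ?thesis
      unfolding osc_radial_integral[OF adm lam] by (simp only: mult_ac)
  qed
  \<comment> \<open>Integrability on the sphere is inherited from the polar decomposition of an
    integrable function, after dividing by the nonzero \<open>Gamma (- \<beta>)\<close>.\<close>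
  have int_sd: "integrable sphere_measure (\<lambda>\<phi>. of_real (m' \<phi>) * (?s \<phi> + ?d \<phi>))"
  proof -
    have A: "integrable sphere_measure (\<lambda>\<phi>. of_real (Gamma (- \<beta>)) * (of_real (m' \<phi>) * (?s \<phi> + ?d \<phi>)))"
      using integrable_polar[OF integrable_osc_K'[of k]]
      by (subst (asm) Bochner_Integration.integrable_cong[OF refl rad])
    have cancel: "integrable M f" if "integrable M (\<lambda>x. c * f x)" "c \<noteq> 0" for M c and f :: "'a \<Rightarrow> complex"
      using integrable_mult_right[of "inverse c" M "\<lambda>x. c * f x"] that by (simp flip: mult.assoc)
    from cancel[OF A G0] show ?thesis .
  qed
  have int_d: "integrable sphere_measure (\<lambda>\<phi>. of_real (m' \<phi>) * ?d \<phi>)"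
    and eq_d: "(LINT \<phi>|sphere_measure. of_real (m' \<phi>) * ?d \<phi>) =
      of_bool b * (\<i> * of_real (\<beta> * lam powr (\<beta> - 1) * (k \<bullet> drift m)))"
  proof -
    have *: "of_real (m' \<phi>) * ?d \<phi> = (of_bool b * \<i> * of_real (\<beta> * lam powr (\<beta> - 1))) * complex_of_real (m' \<phi> * (k \<bullet> \<phi>))" for \<phi>
      by (simp add: mult_ac)
    have i: "integrable sphere_measure (\<lambda>\<phi>. m' \<phi> * (k \<bullet> \<phi>))"
      using integrable_inner_right[OF integrable_m'_scaleR, of k] by simp
    show "integrable sphere_measure (\<lambda>\<phi>. of_real (m' \<phi>) * ?d \<phi>)"
      unfolding * by (intro integrable_mult_right integrable_of_real i)
    show "(LINT \<phi>|sphere_measure. of_real (m' \<phi>) * ?d \<phi>) =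
      of_bool b * (\<i> * of_real (\<beta> * lam powr (\<beta> - 1) * (k \<bullet> drift m)))"
      unfolding * integral_mult_right_zero integral_complex_of_real inner_drift by simp
  qed
  have int_s: "integrable sphere_measure (\<lambda>\<phi>. ?s \<phi> * of_real (m' \<phi>))"
    using Bochner_Integration.integrable_diff[OF int_sd int_d] by (simp add: algebra_simps)
  have "symbol k = (LINT \<phi>|sphere_measure. ?s \<phi> * of_real (m' \<phi>))"
    unfolding symbol_def surface_measure_eq
  proof (rule integral_completion_AE)
    show "AE \<phi> in sphere_measure. ?s \<phi> * of_real (m \<phi>) = ?s \<phi> * of_real (m' \<phi>)"
      using m'_AE by eventually_elim simp
  qed (use int_s in auto)
  moreover have "(LINT \<phi>|sphere_measure. of_real (m' \<phi>) * (?s \<phi> + ?d \<phi>)) =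
      (LINT \<phi>|sphere_measure. ?s \<phi> * of_real (m' \<phi>)) + (LINT \<phi>|sphere_measure. of_real (m' \<phi>) * ?d \<phi>)"
    by (subst Bochner_Integration.integral_add[OF int_s int_d, symmetric])
      (simp only: distrib_left mult.commute)
  moreover have "(LINT Y|lborel. osc b (k \<bullet> Y) * of_real (K' Y)) =
      of_real (Gamma (- \<beta>)) * (LINT \<phi>|sphere_measure. of_real (m' \<phi>) * (?s \<phi> + ?d \<phi>))"
    unfolding integral_polar[OF integrable_osc_K'] integral_mult_right_zero[symmetric]
    by (rule Bochner_Integration.integral_cong[OF refl rad])
  ultimately show ?thesis by (simp only: eq_d)
qed

end

section \<open>The operator on Schwartz functions\<close>

lemma dot_grad_minus: "dot_grad (- v) p X = - dot_grad v p X"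
  by (simp add: dot_grad_def sum_negf)

lemma dot_grad_0: "dot_grad 0 p X = 0"
  by (simp add: dot_grad_def)

context tempered_density
begin

section \<open>Cancellation for symmetric densities\<close>

lemma K_symmetric:
  assumes "sphere_symmetric m"
  shows "K (- Y) = K Y"
proof (cases "Y = 0")
  case False
  then have "Y /\<^sub>R norm Y \<in> sphere 0 1" by simp
  with assms have "m (- (Y /\<^sub>R norm Y)) = m (Y /\<^sub>R norm Y)" unfolding sphere_symmetric_def by blast
  then show ?thesis by (simp add: tempered_kernel_def)
qed simp

text \<open>For functions dominated by \<open>weight b\<close>, the kernel \<open>K\<close> with
  Lebesgue measure may be exchanged for its Borel version \<open>K'\<close>, since the two agree
  almost everywhere.\<close>

lemma
  assumes f: "f \<in> borel_measurable borel" and le: "\<And>Y. norm (f Y :: complex) \<le> C * weight b (norm Y)"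
  shows integrable_mult_K': "integrable lborel (\<lambda>Y. f Y * of_real (K' Y))"
    and integrable_mult_K: "integrable lebesgue (\<lambda>Y. f Y * of_real (K Y))"
    and integral_mult_K: "(LINT Y|lebesgue. f Y * of_real (K Y)) = (LINT Y|lborel. f Y * of_real (K' Y))"
proof -
  note f[measurable]
  have eq: "AE Y in lborel. f Y * of_real (K Y) = f Y * of_real (K' Y)"
    using K_AE by eventually_elim simp
  have m: "(\<lambda>Y. f Y * of_real (K' Y)) \<in> borel_measurable lborel" by measurable
  show i: "integrable lborel (\<lambda>Y. f Y * of_real (K' Y))"
  proof (rule Bochner_Integration.integrable_bound[OF _ m])
    show "integrable lborel (\<lambda>Y. C * (weight b (norm Y) * K' Y))" using integrable_weight_K' by simp
    show "AE Y in lborel. norm (f Y * of_real (K' Y)) \<le> norm (C * (weight b (norm Y) * K' Y))"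
    proof (rule AE_I2)
      fix Y
      show "norm (f Y * of_real (K' Y)) \<le> norm (C * (weight b (norm Y) * K' Y))"
        using mult_right_mono[OF le[of Y] K'_nonneg[of Y]] K'_nonneg[of Y] abs_ge_self[of "C * (weight b (norm Y) * K' Y)"]
        by (simp add: norm_mult mult.assoc)
    qed
  qed
  show "integrable lebesgue (\<lambda>Y. f Y * of_real (K Y))"
    using i integrable_completion_AE[OF eq m] by simp
  show "(LINT Y|lebesgue. f Y * of_real (K Y)) = (LINT Y|lborel. f Y * of_real (K' Y))"
    by (rule integral_completion_AE[OF eq m])
qed

lemma incr_le:
  fixes p :: "'a \<Rightarrow> complex"
  assumes "schwartz p"
  obtains C where "\<And>X Y. norm (incr b p X Y) \<le> C * weight b (norm Y)"
proof -
  obtain C where C: "0 \<le> C" "\<And>X Y. norm (incr b p X Y) \<le> C * weight b (norm Y) * (decay X + decay (X - Y))"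
    using incr_bound[OF assms] by blast
  show thesis
  proof (rule that)
    fix X Y :: 'a
    have "C * weight b (norm Y) * (decay X + decay (X - Y)) \<le> C * weight b (norm Y) * 2"
      using C(1) decay_le_1[of X] decay_le_1[of "X - Y"] by (intro mult_left_mono) (auto simp: weight_nonneg)
    with C(2)[of X Y] show "norm (incr b p X Y) \<le> (C * 2) * weight b (norm Y)" by (simp add: mult_ac)
  qed
qed

lemma incr_borel:
  fixes p :: "'a \<Rightarrow> complex"
  assumes "schwartz p"
  shows "(\<lambda>Y. incr b p X Y) \<in> borel_measurable borel"
  using measurable_compose[OF measurable_Pair2' incr_measurable[OF assms, of b], of X] by simp

lemma dot_grad_arg_borel: "(\<lambda>Y. dot_grad Y p X) \<in> borel_measurable borel"
  unfolding dot_grad_def by measurable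

text \<open>Near 0 a linear bound lacks one of the two powers in \<open>weight True\<close>; outside
  the ball of radius \<epsilon> the missing factor \<open>min 1 (norm Y)\<close> is at least
  \<open>min 1 \<epsilon>\<close>.\<close>

lemma far_linear_le:
  assumes "0 < \<epsilon>" "b" "\<And>Y. norm (g Y :: complex) \<le> C * norm Y" "0 \<le> C"
  shows "norm (indicator {Y. \<epsilon> < norm Y} Y *\<^sub>R g Y) \<le> (C / min 1 \<epsilon>) * weight b (norm (Y :: 'a))"
proof (cases "\<epsilon> < norm Y")
  case True
  then have "min 1 \<epsilon> \<le> min 1 (norm Y)" by auto
  then have "C * norm Y * min 1 \<epsilon> \<le> C * norm Y * min 1 (norm Y)"
    using assms(4) by (intro mult_left_mono) auto
  then have "C * norm Y \<le> (C / min 1 \<epsilon>) * (norm Y * min 1 (norm Y))"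
    using assms(1) by (simp add: pos_le_divide_eq)
  then show ?thesis using assms(2) assms(3)[of Y] True by (simp add: weight_def)
next
  case False
  then show ?thesis using assms by (simp add: weight_nonneg)
qed

lemma dot_grad_linear_le:
  fixes p :: "'a \<Rightarrow> complex"
  assumes "schwartz p"
  obtains C where "0 \<le> C" "\<And>Y. norm (dot_grad Y p X) \<le> C * norm (Y :: 'a)"
proof -
  obtain C where C: "0 \<le> C" "\<And>v X. norm (dot_grad v p X) \<le> C * norm v * decay X"
    using schwartz_dot_grad_decay[OF assms] by blast
  show thesis
  proof (rule that[OF C(1)])
    fix Y :: 'a
    have "C * norm Y * decay X \<le> C * norm Y * 1"
      using C(1) decay_le_1 by (intro mult_left_mono) auto
    with C(2)[of Y X] show "norm (dot_grad Y p X) \<le> C * norm Y" by simp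
  qed
qed

text \<open>The kernel is even, so the truncated product is odd; \<open>far_linear_le\<close> makes
  it integrable.\<close>

lemma far_odd_integral:
  assumes "sphere_symmetric m" "b" "0 < \<epsilon>"
    and g: "g \<in> borel_measurable borel" "\<And>Y. norm (g Y :: complex) \<le> C * norm (Y :: 'a)" "0 \<le> C" "\<And>Y. g (- Y) = - g Y"
  shows "integrable lebesgue (\<lambda>Y. (indicator {Y. \<epsilon> < norm Y} Y *\<^sub>R g Y) * of_real (K Y))"
    and "(LINT Y|lebesgue. (indicator {Y. \<epsilon> < norm Y} Y *\<^sub>R g Y) * of_real (K Y)) = 0"
proof -
  note g(1)[measurable]
  have m: "(\<lambda>Y. indicator {Y. \<epsilon> < norm Y} Y *\<^sub>R g Y) \<in> borel_measurable borel" by measurable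
  show i: "integrable lebesgue (\<lambda>Y. (indicator {Y. \<epsilon> < norm Y} Y *\<^sub>R g Y) * of_real (K Y))"
    by (rule integrable_mult_K[OF m far_linear_le[OF assms(3,2) g(2,3)]])
  show "(LINT Y|lebesgue. (indicator {Y. \<epsilon> < norm Y} Y *\<^sub>R g Y) * of_real (K Y)) = 0"
    by (rule integral_lebesgue_odd[OF borel_measurable_integrable[OF i]])
      (simp add: K_symmetric[OF assms(1)] g(4) indicator_def)
qed

text \<open>Derived from reflection of the whole space instead of the sphere: the odd integral of
  \<open>k \<bullet> Y\<close> outside the unit ball vanishes, and with \<open>k = drift m\<close>
  polar coordinates turn it into \<open>(k \<bullet> k) * q\<close> with a nonzero radial factor
  \<open>q\<close>.\<close>

lemma drift_symmetric:
  assumes sym: "sphere_symmetric m" and b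
  shows "drift m = 0"
proof -
  define k where "k = drift m"
  let ?g = "\<lambda>Y. complex_of_real (k \<bullet> Y)"
  let ?f = "\<lambda>Y. indicator {Y. 1 < norm Y} Y *\<^sub>R ?g Y"
  let ?h = "\<lambda>r. indicator {1<..} r * r * (exp (- (lam * r)) * r powr (- 1 - \<beta>))"
  define q where "q = (LINT r|halfline. ?h r)"
  have g: "norm (?g Y) \<le> norm k * norm Y" for Y
    using Cauchy_Schwarz_ineq2[of k Y] by simp
  have fm: "?f \<in> borel_measurable borel" by measurable
  have fle: "norm (?f Y) \<le> (norm k / min 1 1) * weight b (norm Y)" for Y
    using \<open>b\<close> g by (intro far_linear_le) auto
  have "(LINT Y|lebesgue. ?f Y * of_real (K Y)) = 0"
    using sym \<open>b\<close> g by (intro far_odd_integral(2)) auto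
  then have "0 = (LINT Y|lborel. ?f Y * of_real (K' Y))"
    using integral_mult_K[OF fm fle] by simp
  also have "\<dots> = (LINT \<phi>|sphere_measure. complex_of_real (m' \<phi> * (k \<bullet> \<phi>) * q))"
    unfolding integral_polar[OF integrable_mult_K'[OF fm fle]]
  proof (rule Bochner_Integration.integral_cong[OF refl])
    fix \<phi> :: 'a assume "\<phi> \<in> space sphere_measure"
    then have \<phi>: "\<phi> \<in> sphere 0 1" by simp
    have "(LINT r|halfline. r ^ (DIM('a) - 1) *\<^sub>R (?f (r *\<^sub>R \<phi>) * of_real (K' (r *\<^sub>R \<phi>)))) =
        (LINT r|halfline. complex_of_real (m' \<phi> * (k \<bullet> \<phi>) * ?h r))"
    proof (rule Bochner_Integration.integral_cong[OF refl])
      fix r assume "r \<in> space halfline"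
      then have r: "0 < r" by simp
      have "r ^ (DIM('a) - 1) *\<^sub>R (?f (r *\<^sub>R \<phi>) * of_real (K' (r *\<^sub>R \<phi>))) =
          complex_of_real (indicator {1<..} r * r * (k \<bullet> \<phi>) * (r ^ (DIM('a) - 1) * K' (r *\<^sub>R \<phi>)))"
        using r \<phi> by (simp add: scaleR_conv_of_real indicator_def mult_ac)
      then show "r ^ (DIM('a) - 1) *\<^sub>R (?f (r *\<^sub>R \<phi>) * of_real (K' (r *\<^sub>R \<phi>))) = complex_of_real (m' \<phi> * (k \<bullet> \<phi>) * ?h r)"
        unfolding K'_polar[OF \<phi> r] by (simp only: mult_ac)
    qed
    then show "(LINT r|halfline. r ^ (DIM('a) - 1) *\<^sub>R (?f (r *\<^sub>R \<phi>) * of_real (K' (r *\<^sub>R \<phi>)))) =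
        complex_of_real (m' \<phi> * (k \<bullet> \<phi>) * q)"
      unfolding integral_complex_of_real integral_mult_right_zero q_def .
  qed
  also have "\<dots> = complex_of_real ((k \<bullet> k) * q)"
    unfolding integral_complex_of_real integral_mult_left_zero inner_drift k_def ..
  finally have kq: "(k \<bullet> k) * q = 0" by (metis of_real_eq_0_iff)
  \<comment> \<open>Otherwise the nonnegative integrand would vanish almost everywhere, but it is
    positive between 1 and 2.\<close>
  have "q \<noteq> 0"
  proof
    assume "q = 0"
    have int: "integrable halfline ?h"
    proof (rule Bochner_Integration.integrable_bound[OF integrable_weight[OF adm]])
      show "AE r in halfline. norm (?h r) \<le> norm (weight b r * r powr (- 1 - \<beta>))"
      proof (rule AE_I2)
        fix r assume "r \<in> space halfline"
        then have r: "0 < r" by simp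
        have "indicator {1<..} r * r \<le> weight b r" using r \<open>b\<close> by (auto simp: weight_def indicator_def)
        moreover have "exp (- (lam * r)) * r powr (- 1 - \<beta>) \<le> 1 * r powr (- 1 - \<beta>)"
          using lam r by (intro mult_right_mono) auto
        ultimately have "?h r \<le> weight b r * (1 * r powr (- 1 - \<beta>))"
          using r by (intro mult_mono) (auto simp: weight_nonneg)
        moreover have "0 \<le> ?h r" using r by simp
        ultimately show "norm (?h r) \<le> norm (weight b r * r powr (- 1 - \<beta>))" by simp
      qed
    qed (auto intro!: borel_measurable_halfline)
    have "AE r in halfline. ?h r = 0"
    proof (rule integral_nonneg_eq_0_iff_AE[OF int, THEN iffD1])
      show "AE r in halfline. 0 \<le> ?h r" by (rule AE_I2) simp
    qed (use \<open>q = 0\<close> in \<open>simp only: q_def\<close>)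
    then have "AE r in lborel. r \<in> {0<..} \<longrightarrow> ?h r = 0"
      unfolding halfline_def by (subst (asm) AE_restrict_space_iff) auto
    then have "AE r in lborel. r \<notin> {1<..<2::real}"
      by eventually_elim (auto simp: indicator_def)
    then have "{1<..<2::real} \<in> null_sets lborel"
      by (subst AE_iff_null_sets) auto
    then show False by (auto simp: null_sets_def)
  qed
  with kq show ?thesis by (simp add: k_def)
qed

text \<open>The integral common to all three branches of \<open>frac_laplacian\<close>, taken with
  the Borel kernel so that Fubini applies.\<close>

definition levy :: "('a \<Rightarrow> complex) \<Rightarrow> 'a \<Rightarrow> complex" where
  "levy p X = (LINT Y|lborel. incr b p X Y * of_real (K' Y))"

lemma
  assumes p: "schwartz p"
  shows integrable_incr_K: "integrable lebesgue (\<lambda>Y. incr b p X Y * of_real (K Y))"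
    and integral_incr_K: "(LINT Y|lebesgue. incr b p X Y * of_real (K Y)) = levy p X"
proof -
  obtain C where C: "\<And>X Y. norm (incr b p X Y) \<le> C * weight b (norm Y)" using incr_le[OF p] by blast
  show "integrable lebesgue (\<lambda>Y. incr b p X Y * of_real (K Y))"
    by (rule integrable_mult_K[OF incr_borel[OF p] C])
  show "(LINT Y|lebesgue. incr b p X Y * of_real (K Y)) = levy p X"
    unfolding levy_def by (rule integral_mult_K[OF incr_borel[OF p] C])
qed

lemma principal_value:
  assumes p: "schwartz p" and sym: "sphere_symmetric m" and b
  shows "0 < \<epsilon> \<Longrightarrow> set_integrable lebesgue {Y. \<epsilon> < norm Y} (integrand_I \<beta> lam m p X)"
    and "((\<lambda>\<epsilon>. LINT Y:{Y. \<epsilon> < norm Y}|lebesgue. integrand_I \<beta> lam m p X Y) \<longlongrightarrow> levy p X) (at_right 0)"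
proof -
  let ?F = "\<lambda>Y. incr b p X Y * of_real (K Y)"
  let ?A = "\<lambda>\<epsilon>. {Y::'a. \<epsilon> < norm Y}"
  obtain C where C: "0 \<le> C" "\<And>Y. norm (dot_grad Y p X) \<le> C * norm Y"
    using dot_grad_linear_le[OF p] by blast
  have A: "?A \<epsilon> \<in> sets lebesgue" for \<epsilon> by simp
  have F: "integrable lebesgue ?F" by (rule integrable_incr_K[OF p])
  have iA: "integrable lebesgue (\<lambda>Y. indicator (?A \<epsilon>) Y *\<^sub>R ?F Y)" for \<epsilon>
    using F A by (rule integrable_mult_indicator[rotated])
  have eq: "indicator (?A \<epsilon>) Y *\<^sub>R integrand_I \<beta> lam m p X Y =
      indicator (?A \<epsilon>) Y *\<^sub>R ?F Y - (indicator (?A \<epsilon>) Y *\<^sub>R dot_grad Y p X) * of_real (K Y)" for \<epsilon> Y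
    using \<open>b\<close> by (simp add: integrand_I_def incr_def indicator_def algebra_simps)
  note odd = far_odd_integral[OF sym \<open>b\<close> _ dot_grad_arg_borel C(2,1) dot_grad_minus]
  show "set_integrable lebesgue (?A \<epsilon>) (integrand_I \<beta> lam m p X)" if "0 < \<epsilon>" for \<epsilon>
    unfolding set_integrable_def eq by (intro Bochner_Integration.integrable_diff iA odd(1)[OF that])
  have val: "(LINT Y:?A \<epsilon>|lebesgue. integrand_I \<beta> lam m p X Y) = (LINT Y|lebesgue. indicator (?A \<epsilon>) Y *\<^sub>R ?F Y)"
    if "0 < \<epsilon>" for \<epsilon>
    unfolding set_lebesgue_integral_def eq
    by (subst Bochner_Integration.integral_diff[OF iA odd(1)[OF that]]) (simp only: odd(2)[OF that] diff_zero)
  show "((\<lambda>\<epsilon>. LINT Y:?A \<epsilon>|lebesgue. integrand_I \<beta> lam m p X Y) \<longlongrightarrow> levy p X) (at_right 0)"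
    unfolding tendsto_at_iff_sequentially
  proof (intro allI impI)
    fix E :: "nat \<Rightarrow> real"
    assume "\<forall>i. E i \<in> {0<..} - {0}" and E: "E \<longlonglongrightarrow> 0"
    then have pos: "0 < E i" for i by auto
    \<comment> \<open>The truncations are dominated by the integrable \<open>?F\<close> and
      eventually equal it at each \<open>Y \<noteq> 0\<close>; at the origin the kernel is
      0.\<close>
    have "(\<lambda>i. LINT Y|lebesgue. indicator (?A (E i)) Y *\<^sub>R ?F Y) \<longlonglongrightarrow> (LINT Y|lebesgue. ?F Y)"
    proof (rule integral_dominated_convergence[where w="\<lambda>Y. norm (?F Y)"])
      show "?F \<in> borel_measurable lebesgue" using F by auto
      show "(\<lambda>Y. indicator (?A (E i)) Y *\<^sub>R ?F Y) \<in> borel_measurable lebesgue" for i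
        using iA by auto
      show "integrable lebesgue (\<lambda>Y. norm (?F Y))" using F by (rule integrable_norm)
      show "AE Y in lebesgue. (\<lambda>i. indicator (?A (E i)) Y *\<^sub>R ?F Y) \<longlonglongrightarrow> ?F Y"
      proof (rule AE_I2)
        fix Y :: 'a
        show "(\<lambda>i. indicator (?A (E i)) Y *\<^sub>R ?F Y) \<longlonglongrightarrow> ?F Y"
        proof (cases "Y = 0")
          case False
          then have "\<forall>\<^sub>F i in sequentially. E i < norm Y"
            using order_tendstoD(2)[OF E, of "norm Y"] by simp
          then have "\<forall>\<^sub>F i in sequentially. indicator (?A (E i)) Y *\<^sub>R ?F Y = ?F Y"
            by eventually_elim simp
          then show ?thesis by (rule tendsto_eventually)
        qed simp
      qed
      show "AE Y in lebesgue. norm (indicator (?A (E i)) Y *\<^sub>R ?F Y) \<le> norm (?F Y)" for i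
        by (intro AE_I2) (simp add: indicator_def)
    qed
    then show "((\<lambda>\<epsilon>. LINT Y:?A \<epsilon>|lebesgue. integrand_I \<beta> lam m p X Y) \<circ> E) \<longlonglongrightarrow> levy p X"
      unfolding o_def val[OF pos] integral_incr_K[OF p] .
  qed
qed

text \<open>One formula for all branches: \<open>of_bool b\<close> removes the drift term for
  \<beta> < 1, and \<open>drift_symmetric\<close> makes it vanish in the principal value
  branch.\<close>

lemma
  assumes p: "schwartz p"
  shows frac_laplacian_existence: "frac_laplacian_exists \<beta> lam m p X"
    and frac_laplacian_eq: "frac_laplacian \<beta> lam m p X =
      of_real (1 / \<bar>Gamma (- \<beta>)\<bar>) * levy p X
      - of_real (of_bool b * (Gamma (1 - \<beta>) * lam powr (\<beta> - 1) / \<bar>Gamma (- \<beta>)\<bar>)) * dot_grad (drift m) p X"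
proof -
  let ?F = "\<lambda>Y. incr b p X Y * of_real (K Y)"
  have F0: "indicator (- {0}) Y *\<^sub>R ?F Y = ?F Y" for Y
    by (cases "Y = 0") auto
  have si: "set_integrable lebesgue (- {0}) ?F" "(LINT Y:- {0}|lebesgue. ?F Y) = levy p X"
    unfolding set_integrable_def set_lebesgue_integral_def F0
    by (rule integrable_incr_K[OF p], rule integral_incr_K[OF p])
  consider "\<not> b" | "b" "sphere_symmetric m" | "b" "\<not> sphere_symmetric m" by blast
  then have "frac_laplacian_exists \<beta> lam m p X \<and> frac_laplacian \<beta> lam m p X =
      of_real (1 / \<bar>Gamma (- \<beta>)\<bar>) * levy p X
      - of_real (of_bool b * (Gamma (1 - \<beta>) * lam powr (\<beta> - 1) / \<bar>Gamma (- \<beta>)\<bar>)) * dot_grad (drift m) p X"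
  proof cases
    case 1
    then have "\<beta> < 1" using adm by (auto simp: admissible_def)
    moreover have "integrand_I \<beta> lam m p X = ?F"
      using 1 by (intro ext) (simp add: integrand_I_def incr_def)
    ultimately show ?thesis
      using si 1 by (simp add: frac_laplacian_exists_def frac_laplacian_def)
  next
    case 2
    then have \<beta>: "\<not> \<beta> < 1" using adm by (auto simp: admissible_def)
    note pv = principal_value[OF p 2(2,1), where X=X]
    have "Lim (at_right 0) (\<lambda>\<epsilon>. LINT Y:{Y. \<epsilon> < norm Y}|lebesgue. integrand_I \<beta> lam m p X Y) = levy p X"
      using pv(2) by (intro tendsto_Lim) auto
    then show ?thesis
      using 2 \<beta> pv drift_symmetric[OF 2(2,1)]
      unfolding frac_laplacian_exists_def frac_laplacian_def by (auto simp: dot_grad_0)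
  next
    case 3
    then have \<beta>: "\<not> \<beta> < 1" using adm by (auto simp: admissible_def)
    moreover have "integrand_II \<beta> lam m p X = ?F"
      using 3 by (intro ext) (simp add: integrand_II_def incr_def)
    ultimately show ?thesis
      using si 3 by (simp add: frac_laplacian_exists_def frac_laplacian_def)
  qed
  then show "frac_laplacian_exists \<beta> lam m p X" and "frac_laplacian \<beta> lam m p X =
      of_real (1 / \<bar>Gamma (- \<beta>)\<bar>) * levy p X
      - of_real (of_bool b * (Gamma (1 - \<beta>) * lam powr (\<beta> - 1) / \<bar>Gamma (- \<beta>)\<bar>)) * dot_grad (drift m) p X"
    by blast+
qed

lemma
  assumes p: "schwartz p"
  shows integrable_frac_laplacian: "integrable lebesgue (frac_laplacian \<beta> lam m p)"
    and fourier_frac_laplacian: "fourier (frac_laplacian \<beta> lam m p) k =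
      (- 1) ^ nat \<lceil>\<beta>\<rceil> * symbol k * fourier p k"
proof -
  let ?G = "\<bar>Gamma (- \<beta>)\<bar>"
  let ?c = "complex_of_real (1 / ?G)"
  let ?d = "complex_of_real (of_bool b * (Gamma (1 - \<beta>) * lam powr (\<beta> - 1) / ?G))"
  let ?D = "drift m"
  let ?e = "\<lambda>X. exp (\<i> * complex_of_real (k \<bullet> X))"
  note levy = K'_borel K'_nonneg integrable_weight_K'
  have L: "integrable lborel (levy p)"
    unfolding levy_def[abs_def] by (rule integrable_integral_incr[OF p levy])
  have dg: "integrable lborel (dot_grad ?D p)"
    by (rule schwartz_dot_grad_integrable[OF p])
  have eq: "frac_laplacian \<beta> lam m p = (\<lambda>X. ?c * levy p X - ?d * dot_grad ?D p X)"
    by (rule ext) (rule frac_laplacian_eq[OF p])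
  have int: "integrable lborel (frac_laplacian \<beta> lam m p)"
    unfolding eq by (intro Bochner_Integration.integrable_diff integrable_mult_right L dg)
  then show "integrable lebesgue (frac_laplacian \<beta> lam m p)"
    by (subst integrable_completion) auto
  have G: "Gamma (- \<beta>) \<noteq> 0"
    using admissible_not_nonpos_Ints[OF adm] by (simp add: Gamma_eq_zero_iff)
  have "fourier (frac_laplacian \<beta> lam m p) k = (LINT X|lborel. ?e X * frac_laplacian \<beta> lam m p X)"
    by (rule fourier_eq_lborel) (use int in simp)
  also have "\<dots> = (LINT X|lborel. ?c * (?e X * levy p X) - ?d * (?e X * dot_grad ?D p X))"
    unfolding eq by (simp only: right_diff_distrib mult.left_commute)
  also have "\<dots> = ?c * (LINT X|lborel. ?e X * levy p X) - ?d * (LINT X|lborel. ?e X * dot_grad ?D p X)"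
    by (subst Bochner_Integration.integral_diff)
      (intro integrable_mult_right integrable_exp_mult L dg | simp only: integral_mult_right_zero)+
  also have "(LINT X|lborel. ?e X * levy p X) = fourier (levy p) k"
    by (rule fourier_eq_lborel[symmetric]) (use L in simp)
  also have "fourier (levy p) k = of_real (Gamma (- \<beta>)) *
     (symbol k + of_bool b * (\<i> * of_real (\<beta> * lam powr (\<beta> - 1) * (k \<bullet> ?D)))) * fourier p k"
    unfolding levy_def[abs_def] fourier_integral_incr[OF p levy] integral_osc_K' ..
  also have "(LINT X|lborel. ?e X * dot_grad ?D p X) = - \<i> * of_real (k \<bullet> ?D) * fourier p k"
    by (rule fourier_dot_grad[OF p])
  \<comment> \<open>The drift term contributes \<open>\<i> * Gamma (1 - \<beta>) * lam powr (\<beta>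
    - 1) * (k \<bullet> drift m)\<close>, up to the common normalization; as
    \<open>Gamma (1 - \<beta>) = - \<beta> * Gamma (- \<beta>)\<close>, it cancels the linear term
    of the integral.\<close>
  also have "?c * (of_real (Gamma (- \<beta>)) *
     (symbol k + of_bool b * (\<i> * of_real (\<beta> * lam powr (\<beta> - 1) * (k \<bullet> ?D)))) * fourier p k) -
     ?d * (- \<i> * of_real (k \<bullet> ?D) * fourier p k) = of_real (Gamma (- \<beta>) / ?G) * symbol k * fourier p k"
    using G by (simp add: Gamma_one_minus[OF adm] field_simps)
  also have "of_real (Gamma (- \<beta>) / ?G) = (- 1 :: complex) ^ nat \<lceil>\<beta>\<rceil>"
    unfolding Gamma_sign[OF adm] by simp
  finally show "fourier (frac_laplacian \<beta> lam m p) k = (- 1) ^ nat \<lceil>\<beta>\<rceil> * symbol k * fourier p k" .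
qed

end

theorem theorem3p1:
  fixes m :: "'a::euclidean_space \<Rightarrow> real" and lam \<beta> :: real
  assumes "sphere_density m"
    and "0 \<le> lam"
    and "\<beta> \<in> {0<..<1} \<union> {1<..<2}"
  shows "(\<forall>p :: 'a \<Rightarrow> complex. schwartz p \<longrightarrow>
            (\<forall>X. frac_laplacian_exists \<beta> lam m p X) \<and>
            integrable lebesgue (frac_laplacian \<beta> lam m p) \<and>
            (\<forall>k. fourier (frac_laplacian \<beta> lam m p) k =
                   (- 1) ^ nat \<lceil>\<beta>\<rceil> *
                   (LINT \<phi>|surface_measure.
                      ((complex_of_real lam - \<i> * complex_of_real (k \<bullet> \<phi>)) powr complex_of_real \<beta>
                        - complex_of_real (lam powr \<beta>)) * complex_of_real (m \<phi>)) *
                   fourier p k)) \<and>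
         (\<forall>p :: 'a \<Rightarrow> complex. schwartz p \<longrightarrow>
            (\<forall>k. fourier (frac_laplacian \<beta> 0 m p) k =
                   (- 1) ^ nat \<lceil>\<beta>\<rceil> *
                   (LINT \<phi>|surface_measure.
                      (- \<i> * complex_of_real (k \<bullet> \<phi>)) powr complex_of_real \<beta>
                        * complex_of_real (m \<phi>)) *
                   fourier p k))"
proof -
  have adm: "admissible \<beta> (1 < \<beta>)"
    using assms(3) by (auto simp: admissible_def)
  obtain m' :: "'a \<Rightarrow> real" where m': "m' \<in> borel_measurable borel" "\<And>x. 0 \<le> m' x"
    "AE \<phi> in sphere_measure. m \<phi> = m' \<phi>"
    using sphere_density_borel[OF assms(1)] by blast
  interpret T: tempered_density m m' lam \<beta> "1 < \<beta>"
    using assms(1,2) adm m' by unfold_locales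
  \<comment> \<open>At rate 0 the term \<open>0 powr \<beta>\<close> is 0, which gives the form of
    the second claim.\<close>
  interpret T0: tempered_density m m' 0 \<beta> "1 < \<beta>"
    using assms(1) adm m' by unfold_locales auto
  show ?thesis
    using T.frac_laplacian_existence T.integrable_frac_laplacian
      T.fourier_frac_laplacian[unfolded T.symbol_def] T0.fourier_frac_laplacian[unfolded T0.symbol_def]
    by simp
qed

end
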